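(* Let $\tau:\mathcal A\to\mathcal A^+$ be a substitution satisfying the standing assumptions below which is left proper and quasi-invertible, with fixed point $u$. Then there exists a semi-proper, stationary ordered Bratteli diagram $\mathcal B$ such that $(X_{\mathcal B},V_{\mathcal B})$ is topologically conjugate to $(X_\tau,\sigma)$.
   Context: Substitutions are extended to words and sequences by concatenation; $\tau$ is left proper if some letter is the first letter of every $\tau(a)$. $u$ is a fixed point ($\tau(u)=u$, $u\in\mathcal A^{\mathbb N}$), $\sigma$ is the left shift and $X_\tau$ the closure of $\{\sigma^n(u)\}$. A branch point is a point of $X_\tau$ with more than one $\sigma$-preimage in $X_\tau$; quasi-invertible means exactly one branch point. Standing assumptions: $\tau$ primitive, $X_\tau$ infinite, $\tau$ unilaterally recognizable (with $E=\{0\}\cup\{|\tau(u_0\cdots u_{p-1})|:p>0\}$ there is $L$ with $u_{[i,i+L-1]}=u_{[j,j+L-1]}$, $i\in E$ implying $j\in E$), all powers of $\tau$ injective on letters. An ordered Bratteli diagram has finite vertex sets $V_0=\{v_0\},V_1,\ldots$, finite edge sets $E_n$ ($n\ge1$) with source $s:E_n\to V_{n-1}$ and range $r:E_n\to V_n$ (every vertex a source, every vertex but $v_0$ a range), and a linear order on $r^{-1}(a)$ for every vertex $a\neq v_0$. It is stationary if there is a substitution $\theta$ on an alphabet $V$ with $V_n=V$ for $n\ge1$ and, for $n\ge2$, the edges with range $a$, in increasing order, have as sources the successive letters of $\theta(a)$ ($E_1$ and its order may be arbitrary). $X_{\mathcal B}$ is the space of infinite paths $(x_n)$, $x_n\in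 E_n$, $s(x_{n+1})=r(x_n)$, with the product topology; maximal/minimal paths consist of maximal/minimal edges. $\mathcal B$ is simple if some power of the incidence matrix of $\theta$ is positive. For non-maximal $x$, with $k$ least such that $x_k$ is not maximal and $y_k$ the successor of $x_k$, $V_{\mathcal B}(x)=(z_1,\ldots,z_{k-1},y_k,x_{k+1},\ldots)$ where $z_1\cdots z_{k-1}$ is the minimal path from $v_0$ to $s(y_k)$. $\mathcal B$ is semi-proper if it is simple and has a unique minimal path $m$; then $V_{\mathcal B}$ is extended to all of $X_{\mathcal B}$ by sending every maximal path to $m$. *)

theory Defs
  imports "HOL-Analysis.Analysis"
begin

definition subst_word :: "('a \<Rightarrow> 'a list) \<Rightarrow> 'a list \<Rightarrow> 'a list" where
  "subst_word \<tau> w = concat (map \<tau> w)"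

definition subst_pow :: "('a \<Rightarrow> 'a list) \<Rightarrow> nat \<Rightarrow> 'a \<Rightarrow> 'a list" where
  "subst_pow \<tau> n a = ((subst_word \<tau>) ^^ n) [a]"

text \<open>Extension to one-sided infinite sequences by concatenation
  (well defined since all images are nonempty).\<close>
definition subst_seq :: "('a \<Rightarrow> 'a list) \<Rightarrow> (nat \<Rightarrow> 'a) \<Rightarrow> (nat \<Rightarrow> 'a)" where
  "subst_seq \<tau> x = (\<lambda>n. subst_word \<tau> (map x [0..<Suc n]) ! n)"

definition is_substitution :: "('a \<Rightarrow> 'a list) \<Rightarrow> bool" where
  "is_substitution \<tau> \<longleftrightarrow> (\<forall>a. \<tau> a \<noteq> [])"

definition incidence :: "('v \<Rightarrow> 'v list) \<Rightarrow> 'v \<Rightarrow> 'v \<Rightarrow> nat" where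
  "incidence \<theta> a b = count_list (\<theta> a) b"

fun incidence_pow :: "'v set \<Rightarrow> ('v \<Rightarrow> 'v list) \<Rightarrow> nat \<Rightarrow> 'v \<Rightarrow> 'v \<Rightarrow> nat" where
  "incidence_pow V \<theta> 0 a b = (if a = b then 1 else 0)"
| "incidence_pow V \<theta> (Suc p) a b = (\<Sum>c\<in>V. incidence_pow V \<theta> p a c * incidence \<theta> c b)"

definition primitive_on :: "'v set \<Rightarrow> ('v \<Rightarrow> 'v list) \<Rightarrow> bool" where
  "primitive_on V \<theta> \<longleftrightarrow> (\<exists>p\<ge>1. \<forall>a\<in>V. \<forall>b\<in>V. incidence_pow V \<theta> p a b > 0)"

definition left_proper :: "('a \<Rightarrow> 'a list) \<Rightarrow> bool" where
  "left_proper \<tau> \<longleftrightarrow> (\<exists>c. \<forall>a. hd (\<tau> a) = c)"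

definition shift :: "(nat \<Rightarrow> 'a) \<Rightarrow> (nat \<Rightarrow> 'a)" where
  "shift x = (\<lambda>n. x (Suc n))"

definition seq_top :: "(nat \<Rightarrow> 'a) topology" where
  "seq_top = product_topology (\<lambda>_. discrete_topology UNIV) UNIV"

definition subst_space :: "(nat \<Rightarrow> 'a) \<Rightarrow> (nat \<Rightarrow> 'a) set" where
  "subst_space u = seq_top closure_of (range (\<lambda>n. (shift ^^ n) u))"

definition branch_point :: "(nat \<Rightarrow> 'a) set \<Rightarrow> (nat \<Rightarrow> 'a) \<Rightarrow> bool" where
  "branch_point X x \<longleftrightarrow> x \<in> X \<and> (\<exists>y1\<in>X. \<exists>y2\<in>X. y1 \<noteq> y2 \<and> shift y1 = x \<and> shift y2 = x)"

definition quasi_invertible :: "(nat \<Rightarrow> 'a) set \<Rightarrow> bool" where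
  "quasi_invertible X \<longleftrightarrow> (\<exists>!x. branch_point X x)"

definition cut_set :: "('a \<Rightarrow> 'a list) \<Rightarrow> (nat \<Rightarrow> 'a) \<Rightarrow> nat set" where
  "cut_set \<tau> u = {0} \<union> {length (subst_word \<tau> (map u [0..<p])) | p. p > 0}"

definition unilaterally_recognizable :: "('a \<Rightarrow> 'a list) \<Rightarrow> (nat \<Rightarrow> 'a) \<Rightarrow> bool" where
  "unilaterally_recognizable \<tau> u \<longleftrightarrow>
     (\<exists>L. \<forall>i j. i \<in> cut_set \<tau> u \<and> map u [i..<i+L] = map u [j..<j+L] \<longrightarrow> j \<in> cut_set \<tau> u)"

text \<open>Canonical encoding (vertices are naturals, V_n = V for n >= 1, the root v_0 is
  separate).  The diagram is given by (V, k, theta):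
  the edges of E_1 with range a are (a,0),...,(a, k a - 1), all with source v_0, ordered by index;
  for n >= 2 the edges of E_n with range a are (a,0),...,(a, |theta a| - 1), where the i-th
  edge has source theta(a)!i and the order is by index.
  A path is x :: nat => nat * nat where x n is the edge of E_(n+1).\<close>

definition stat_bratteli :: "nat set \<Rightarrow> (nat \<Rightarrow> nat) \<Rightarrow> (nat \<Rightarrow> nat list) \<Rightarrow> bool" where
  "stat_bratteli V k \<theta> \<longleftrightarrow> finite V \<and> V \<noteq> {} \<and>
     (\<forall>a\<in>V. k a \<ge> 1) \<and>
     (\<forall>a\<in>V. \<theta> a \<noteq> [] \<and> set (\<theta> a) \<subseteq> V) \<and>
     (\<forall>b\<in>V. \<exists>a\<in>V. b \<in> set (\<theta> a))"

definition edges1 :: "nat set \<Rightarrow> (nat \<Rightarrow> nat) \<Rightarrow> (nat \<times> nat) set" where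
  "edges1 V k = {(a, i). a \<in> V \<and> i < k a}"

definition edges2 :: "nat set \<Rightarrow> (nat \<Rightarrow> nat list) \<Rightarrow> (nat \<times> nat) set" where
  "edges2 V \<theta> = {(a, i). a \<in> V \<and> i < length (\<theta> a)}"

definition src :: "(nat \<Rightarrow> nat list) \<Rightarrow> nat \<times> nat \<Rightarrow> nat" where
  "src \<theta> e = \<theta> (fst e) ! snd e"

definition path_space :: "nat set \<Rightarrow> (nat \<Rightarrow> nat) \<Rightarrow> (nat \<Rightarrow> nat list) \<Rightarrow> (nat \<Rightarrow> nat \<times> nat) set" where
  "path_space V k \<theta> = {x. x 0 \<in> edges1 V k \<and>
      (\<forall>n. x (Suc n) \<in> edges2 V \<theta> \<and> src \<theta> (x (Suc n)) = fst (x n))}"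

definition max_edge :: "(nat \<Rightarrow> nat) \<Rightarrow> (nat \<Rightarrow> nat list) \<Rightarrow> nat \<Rightarrow> nat \<times> nat \<Rightarrow> bool" where
  "max_edge k \<theta> n e \<longleftrightarrow>
     (if n = 0 then snd e = k (fst e) - 1 else snd e = length (\<theta> (fst e)) - 1)"

definition max_path :: "(nat \<Rightarrow> nat) \<Rightarrow> (nat \<Rightarrow> nat list) \<Rightarrow> (nat \<Rightarrow> nat \<times> nat) \<Rightarrow> bool" where
  "max_path k \<theta> x \<longleftrightarrow> (\<forall>n. max_edge k \<theta> n (x n))"

definition min_path :: "(nat \<Rightarrow> nat \<times> nat) \<Rightarrow> bool" where
  "min_path x \<longleftrightarrow> (\<forall>n. snd (x n) = 0)"

definition semi_proper :: "nat set \<Rightarrow> (nat \<Rightarrow> nat) \<Rightarrow> (nat \<Rightarrow> nat list) \<Rightarrow> bool" where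
  "semi_proper V k \<theta> \<longleftrightarrow> primitive_on V \<theta> \<and>
     (\<exists>!m. m \<in> path_space V k \<theta> \<and> min_path m)"

text \<open>Vershik map. For a non-maximal path x, with m the least (0-based) level where x is not
  maximal: level m gets the successor edge, levels > m are unchanged, and levels < m form the
  minimal path from v_0 to the source of the successor edge (going down by the edges of
  index 0). Maximal paths are sent to the unique minimal path.\<close>
definition vershik :: "nat set \<Rightarrow> (nat \<Rightarrow> nat) \<Rightarrow> (nat \<Rightarrow> nat list) \<Rightarrow>
    (nat \<Rightarrow> nat \<times> nat) \<Rightarrow> (nat \<Rightarrow> nat \<times> nat)" where
  "vershik V k \<theta> x =
     (if max_path k \<theta> x then (THE m. m \<in> path_space V k \<theta> \<and> min_path m)
      else (let m = (LEAST n. \<not> max_edge k \<theta> n (x n));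
                y = (fst (x m), snd (x m) + 1)
            in (\<lambda>n. if n < m then (((\<lambda>v. hd (\<theta> v)) ^^ (m - 1 - n)) (src \<theta> y), 0)
                     else if n = m then y else x n)))"

definition top_conjugate :: "'x topology \<Rightarrow> ('x \<Rightarrow> 'x) \<Rightarrow> 'y topology \<Rightarrow> ('y \<Rightarrow> 'y) \<Rightarrow> bool" where
  "top_conjugate X f Y g \<longleftrightarrow>
     (\<exists>h. homeomorphic_map X Y h \<and> (\<forall>x\<in>topspace X. h (f x) = g (h x)))"

end

theory Submission
  imports Defs "HOL-Library.Omega_Words_Fun"
begin

text \<open>
  The minimal path has to be sent to the branch point \<open>b\<close>, which in general is not \<open>u\<close>.  Two preimages
  of \<open>b\<close> have different pasts, and by recognizability so do their images under \<open>\<tau>\<close>; where these images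
  merge there is a branch point, so \<open>\<tau>(b)\<close> is \<open>b\<close> with a prefix \<open>s\<close> removed, that is, \<open>b = s \<tau>(b)\<close>.
  The map \<open>\<Psi>(x) = s \<tau>(x)\<close> fixes \<open>b\<close>, and it sends a small cylinder \<open>C\<close> around \<open>b\<close> into itself.  On the alphabet of return words to \<open>C\<close>, spelled out by \<open>\<kappa>\<close>, the map \<open>\<Psi>\<close>
  becomes a substitution \<open>\<theta>\<close> with \<open>s \<tau>(\<kappa> v) = \<kappa>(\<theta> v) s\<close>.

  The shift is injective except over \<open>b\<close>, and \<open>b\<close> lies in the base of each of the towers defined by \<open>\<kappa>\<close>
  and by the powers of \<open>\<theta>\<close>.  So a point can be traced back uniquely to the base of its tower, although
  the subshift is one-sided.  The resulting addresses are the paths of the diagram given by \<open>\<theta>\<close>.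
  All points of \<open>\<Psi>\<^sup>n(C)\<close> share prefixes with \<open>b\<close> whose length grows with \<open>n\<close>, which makes the coding
  injective and \<open>b\<close> the only point with a minimal path.
\<close>

section \<open>Images of words and sequences under morphisms\<close>

text \<open>Towers with base \<open>T\<close> applied to \<open>X\<close> would not do: that base
  contains \<open>T b = suffix l b\<close>, while \<open>b\<close> itself may lie strictly inside a
  tower, and below \<open>b\<close> the past of a point is ambiguous. Moving the base back by
  \<open>s\<close> puts \<open>b\<close> into it. The price is that \<open>s \<frown> T x\<close>
  need not lie in \<open>X\<close> for every \<open>x\<close>. It does if some past of
  \<open>x\<close> of length \<open>l\<close> has an image ending in \<open>s\<close>. For
  \<open>x = b\<close> all pasts have this property, because \<open>b\<close> is not periodic and so
  backtracking from \<open>suffix l b\<close> to \<open>b\<close> is unique; as there are only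
  finitely many words of length \<open>l\<close> and \<open>X\<close> is closed, the property
  persists on a cylinder around \<open>b\<close>. For two visits of a point to this cylinder,
  \<open>s\<close> can then be carried from the left of the image of the word between them to its
  right. So return words are mapped to products of return words, and one set of codes serves at
  every level, which is what makes the diagram stationary. The first level is different: it counts
  letters of return words.\<close>

abbreviation word_img :: "('v \<Rightarrow> 'b list) \<Rightarrow> 'v list \<Rightarrow> 'b list" where
  "word_img f w \<equiv> concat (map f w)"

text \<open>Reading \<open>Suc n\<close> letters suffices, since their nonerasing image has at least
  \<open>Suc n\<close> letters.\<close>

definition seq_img :: "('v \<Rightarrow> 'b list) \<Rightarrow> (nat \<Rightarrow> 'v) \<Rightarrow> nat \<Rightarrow> 'b" where
  "seq_img f x = (\<lambda>n. word_img f (prefix (Suc n) x) ! n)"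

definition nonerasing :: "('v \<Rightarrow> 'b list) \<Rightarrow> bool" where
  "nonerasing f \<longleftrightarrow> (\<forall>a. f a \<noteq> [])"

abbreviation word_pow :: "('v \<Rightarrow> 'v list) \<Rightarrow> nat \<Rightarrow> 'v \<Rightarrow> 'v list" where
  "word_pow f n a \<equiv> (word_img f ^^ n) [a]"

lemma seq_img_eq_subst_seq: "seq_img \<tau> x = subst_seq \<tau> x"
  by (simp add: seq_img_def subst_seq_def subst_word_def subsequence_def)

lemma shift_eq_suffix: "shift x = suffix 1 x"
  by (simp add: shift_def suffix_def)

lemma funpow_shift: "(shift ^^ n) x = suffix n x"
  by (induction n) (auto simp: shift_eq_suffix add.commute)

lemma prefix_eq_iff: "prefix n x = prefix n y \<longleftrightarrow> (\<forall>i<n. x i = y i)"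
  by (auto simp: list_eq_iff_nth_eq)

lemma prefix_mono_eq: "prefix n x = prefix n y \<Longrightarrow> m \<le> n \<Longrightarrow> prefix m x = prefix m y"
  by (simp add: prefix_eq_iff)

lemma seq_eqI_prefix: "(\<And>n. prefix n x = prefix n y) \<Longrightarrow> x = y"
  by (auto simp: prefix_eq_iff fun_eq_iff)

lemma prefix_suffix_eq: "prefix (k + n) x = prefix (k + n) y \<Longrightarrow> prefix n (suffix k x) = prefix n (suffix k y)"
  by (simp add: prefix_eq_iff del: subsequence_shift)

lemma prefix_conc_eq_iff:
  "prefix (length w + n) (w \<frown> x) = prefix (length w + n) (w \<frown> y) \<longleftrightarrow> prefix n x = prefix n y"
  by simp

lemma conc_eq_prefix: "y = w \<frown> x \<Longrightarrow> n = length w \<Longrightarrow> prefix n y = w"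
  by simp

lemma nonerasing_length: "nonerasing f \<Longrightarrow> 0 < length (f a)"
  by (simp add: nonerasing_def)

lemma length_word_img_ge: "nonerasing f \<Longrightarrow> length w \<le> length (word_img f w)"
proof (induction w)
  case (Cons a w)
  then show ?case using nonerasing_length[of f a] by (cases "f a") auto
qed simp

lemma seq_img_nth:
  assumes "nonerasing f" "n < length (word_img f (prefix m x))"
  shows "seq_img f x n = word_img f (prefix m x) ! n"
proof -
  have 1: "n < length (word_img f (prefix (Suc n) x))"
    using length_word_img_ge[OF assms(1), of "prefix (Suc n) x"] by simp
  have "word_img f (prefix a x) ! n = word_img f (prefix (a + d) x) ! n"
    if "n < length (word_img f (prefix a x))" for a d
    using that by (simp add: subsequence_append nth_append del: subseq_to_Suc)
  note ext = this
  show ?thesis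
  proof (cases "m \<le> Suc n")
    case True
    then show ?thesis using ext[OF assms(2), of "Suc n - m"] by (simp add: seq_img_def del: subseq_to_Suc)
  next
    case False
    then show ?thesis using ext[OF 1, of "m - Suc n"] by (simp add: seq_img_def del: subseq_to_Suc)
  qed
qed

lemma seq_img_conc:
  assumes "nonerasing f"
  shows "seq_img f (w \<frown> x) = word_img f w \<frown> seq_img f x"
proof
  fix n
  have p: "prefix (length w + Suc n) (w \<frown> x) = w @ prefix (Suc n) x"
    by (simp del: subseq_to_Suc)
  have l: "n < length (word_img f (prefix (Suc n) x))"
    using length_word_img_ge[OF assms, of "prefix (Suc n) x"] by simp
  have "seq_img f (w \<frown> x) n = word_img f (w @ prefix (Suc n) x) ! n"
    using l by (subst seq_img_nth[OF assms, where m = "length w + Suc n"]) (simp_all only: p, simp)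
  also have "\<dots> = (word_img f w \<frown> seq_img f x) n"
  proof (cases "n < length (word_img f w)")
    case False
    then have "seq_img f x (n - length (word_img f w)) = word_img f (prefix (Suc n) x) ! (n - length (word_img f w))"
      using l by (intro seq_img_nth[OF assms]) auto
    then show ?thesis using False by (simp add: nth_append)
  qed (simp add: nth_append)
  finally show "seq_img f (w \<frown> x) n = (word_img f w \<frown> seq_img f x) n" .
qed

lemma seq_img_split:
  "nonerasing f \<Longrightarrow> seq_img f x = word_img f (prefix q x) \<frown> seq_img f (suffix q x)"
  by (subst prefix_suffix[of x q]) (rule seq_img_conc)

lemma suffix_seq_img:
  "nonerasing f \<Longrightarrow> suffix (length (word_img f (prefix q x))) (seq_img f x) = seq_img f (suffix q x)"
  by (subst seq_img_split[of f x q]) auto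

lemma seq_img_0: "nonerasing f \<Longrightarrow> i < length (f (x 0)) \<Longrightarrow> seq_img f x i = f (x 0) ! i"
  by (subst seq_img_nth[where m = 1]) auto

lemma prefix_seq_img:
  "nonerasing f \<Longrightarrow> prefix (length (word_img f (prefix q x))) (seq_img f x) = word_img f (prefix q x)"
  by (subst seq_img_split[of f x q]) auto

lemma prefix_seq_img_agree:
  assumes "nonerasing f" "prefix m x = prefix m y"
  shows "prefix (length (word_img f (prefix m x))) (seq_img f x) = prefix (length (word_img f (prefix m x))) (seq_img f y)"
  using prefix_seq_img[OF assms(1), where q = m and x = x] prefix_seq_img[OF assms(1), where q = m and x = y] assms(2) by simp

lemma prefix_seq_img_agree':
  assumes "nonerasing f" "prefix m x = prefix m y"
  shows "prefix m (seq_img f x) = prefix m (seq_img f y)"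
  using prefix_seq_img_agree[OF assms] length_word_img_ge[OF assms(1), of "prefix m x"]
  by (elim prefix_mono_eq) simp

lemma position_in_image:
  assumes "nonerasing f"
  shows "\<exists>q i. i < length (f (x q)) \<and> J = length (word_img f (prefix q x)) + i"
proof (induction J)
  case 0
  show ?case using nonerasing_length[OF assms] by (intro exI[of _ 0]) auto
next
  case (Suc J)
  then obtain q i where qi: "i < length (f (x q))" "J = length (word_img f (prefix q x)) + i" by blast
  show ?case
  proof (cases "Suc i < length (f (x q))")
    case True
    then show ?thesis using qi by (intro exI[of _ q] exI[of _ "Suc i"]) simp
  next
    case False
    then have "Suc J = length (word_img f (prefix (Suc q) x)) + 0" using qi by simp
    then show ?thesis using nonerasing_length[OF assms] by blast
  qed
qed

lemma length_word_img_prefix_mono: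
  "p \<le> q \<Longrightarrow> length (word_img f (prefix p x)) \<le> length (word_img f (prefix q x))"
  by (metis concat_append le_add1 le_add_diff_inverse length_append map_append subsequence_append)

lemma length_word_img_prefix_strict_mono:
  assumes "nonerasing f" "p < q"
  shows "length (word_img f (prefix p x)) < length (word_img f (prefix q x))"
proof -
  have "length (word_img f (prefix p x)) < length (word_img f (prefix (Suc p) x))"
    using nonerasing_length[OF assms(1)] by simp
  also have "\<dots> \<le> length (word_img f (prefix q x))"
    using assms(2) by (intro length_word_img_prefix_mono) simp
  finally show ?thesis .
qed

text \<open>The images of prefixes grow without bound, so they determine \<open>y\<close>. The
  remainders \<open>ys n\<close> are arbitrary, which lets identities between sequences be proved by
  moving one block at a time.\<close>

lemma seq_img_eqI:
  assumes "nonerasing f" "\<And>n. y = word_img f (prefix n x) \<frown> ys n"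
  shows "y = seq_img f x"
proof (rule seq_eqI_prefix)
  fix n
  have l: "n \<le> length (word_img f (prefix n x))"
    using length_word_img_ge[OF assms(1), of "prefix n x"] by simp
  have "prefix (length (word_img f (prefix n x))) y = word_img f (prefix n x)"
    by (rule conc_eq_prefix[OF assms(2)]) simp
  then show "prefix n y = prefix n (seq_img f x)"
    using prefix_mono_eq[OF _ l, of y "seq_img f x"] prefix_seq_img[OF assms(1), where q = n and x = x]
    by simp
qed

lemma word_img_word_img: "word_img f (word_img g w) = word_img (\<lambda>a. word_img f (g a)) w"
  by (induction w) auto

lemma nonerasing_word_img: "nonerasing f \<Longrightarrow> w \<noteq> [] \<Longrightarrow> word_img f w \<noteq> []"
  using length_word_img_ge[of f w] by (metis le_zero_eq length_0_conv)

lemma nonerasing_comp: "nonerasing f \<Longrightarrow> nonerasing g \<Longrightarrow> nonerasing (\<lambda>a. word_img f (g a))"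
  using nonerasing_word_img unfolding nonerasing_def by blast

lemma seq_img_seq_img:
  assumes "nonerasing f" "nonerasing g"
  shows "seq_img f (seq_img g x) = seq_img (\<lambda>a. word_img f (g a)) x"
proof (rule seq_img_eqI[OF nonerasing_comp[OF assms]])
  fix n
  show "seq_img f (seq_img g x) = word_img (\<lambda>a. word_img f (g a)) (prefix n x) \<frown> seq_img f (seq_img g (suffix n x))"
    by (subst seq_img_split[OF assms(2), of x n])
      (simp only: seq_img_conc[OF assms(1)] word_img_word_img)
qed

lemma word_img_pow: "(word_img f ^^ n) w = word_img (word_pow f n) w"
proof (induction n)
  case (Suc n)
  show ?case unfolding funpow.simps o_def Suc by (simp add: word_img_word_img)
qed (simp add: concat_map_singleton)

lemma nonerasing_pow: "nonerasing f \<Longrightarrow> nonerasing (word_pow f n)"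
  by (induction n) (auto simp: nonerasing_def dest: nonerasing_word_img)

lemma seq_img_pow: "nonerasing f \<Longrightarrow> (seq_img f ^^ n) x = seq_img (word_pow f n) x"
proof (induction n)
  case 0
  have "nonerasing (\<lambda>a. [a])" by (simp add: nonerasing_def)
  from seq_img_eqI[OF this, of x x "\<lambda>n. suffix n x"] show ?case by (simp add: concat_map_singleton)
next
  case (Suc n)
  then show ?case by (simp add: seq_img_seq_img nonerasing_pow)
qed

lemma seq_img_split_first:
  "nonerasing f \<Longrightarrow> seq_img f x = f (x 0) \<frown> seq_img f (suffix 1 x)"
  using seq_img_split[of f x 1] by simp

section \<open>The product topology on sequences\<close>

lemma topspace_seq_top [simp]: "topspace seq_top = UNIV"
  by (simp add: seq_top_def)

lemma Hausdorff_seq_top: "Hausdorff_space seq_top"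
  by (simp add: seq_top_def Hausdorff_space_product_topology)

lemma openin_seq_top_cylinder: "openin seq_top {y. prefix n y = prefix n x}"
proof -
  have "{y. prefix n y = prefix n x} = (\<Pi>\<^sub>E i\<in>UNIV. if i < n then {x i} else UNIV)"
    by (auto simp: prefix_eq_iff PiE_def Pi_def extensional_def split: if_splits)
  then show ?thesis unfolding seq_top_def
    by (simp only:) (subst openin_PiE_gen, auto simp: if_distrib)
qed

lemma openin_seq_top_iff:
  "openin seq_top U \<longleftrightarrow> (\<forall>x\<in>U. \<exists>n. \<forall>y. prefix n y = prefix n x \<longrightarrow> y \<in> U)"
proof
  assume U: "openin seq_top U"
  show "\<forall>x\<in>U. \<exists>n. \<forall>y. prefix n y = prefix n x \<longrightarrow> y \<in> U"
  proof
    fix x assume "x \<in> U"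
    with U obtain B where B: "finite {i. B i \<noteq> UNIV}" "x \<in> Pi\<^sub>E UNIV B" "Pi\<^sub>E UNIV B \<subseteq> U"
      unfolding seq_top_def openin_product_topology_alt by auto
    obtain n where "{i. B i \<noteq> UNIV} \<subseteq> {..<n}"
      using finite_nat_bounded[OF B(1)] by blast
    then have n: "\<And>i. B i \<noteq> UNIV \<Longrightarrow> i < n" by blast
    have "y \<in> U" if "prefix n y = prefix n x" for y
    proof -
      have "y i \<in> B i" for i
        using that B(2) n[of i] by (cases "B i = UNIV") (auto simp: prefix_eq_iff PiE_def Pi_def)
      then show ?thesis using B(3) by (auto simp: PiE_def Pi_def)
    qed
    then show "\<exists>n. \<forall>y. prefix n y = prefix n x \<longrightarrow> y \<in> U" by blast
  qed
next
  assume H: "\<forall>x\<in>U. \<exists>n. \<forall>y. prefix n y = prefix n x \<longrightarrow> y \<in> U"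
  show "openin seq_top U"
  proof (subst openin_subopen, intro ballI)
    fix x assume "x \<in> U"
    with H obtain n where "\<forall>y. prefix n y = prefix n x \<longrightarrow> y \<in> U" by blast
    then show "\<exists>T. openin seq_top T \<and> x \<in> T \<and> T \<subseteq> U"
      using openin_seq_top_cylinder[of n x] by blast
  qed
qed

lemma closedin_seq_top_iff:
  "closedin seq_top S \<longleftrightarrow> (\<forall>x. (\<forall>n. \<exists>y\<in>S. prefix n y = prefix n x) \<longrightarrow> x \<in> S)"
  unfolding closedin_def openin_seq_top_iff topspace_seq_top by blast

lemma closedin_seq_topD:
  "closedin seq_top S \<Longrightarrow> (\<And>n. \<exists>y\<in>S. prefix n y = prefix n x) \<Longrightarrow> x \<in> S"
  unfolding closedin_seq_top_iff by blast

lemma closure_of_seq_top: "x \<in> seq_top closure_of S \<longleftrightarrow> (\<forall>n. \<exists>y\<in>S. prefix n y = prefix n x)"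
proof
  assume "x \<in> seq_top closure_of S"
  then have "\<forall>T. x \<in> T \<and> openin seq_top T \<longrightarrow> (\<exists>y. y \<in> S \<and> y \<in> T)"
    unfolding in_closure_of by (rule conjunct2)
  from this[THEN spec, THEN mp, OF conjI[OF _ openin_seq_top_cylinder]]
  have "\<exists>y. y \<in> S \<and> y \<in> {y. prefix n y = prefix n x}" for n
    by (metis (mono_tags) mem_Collect_eq)
  then show "\<forall>n. \<exists>y\<in>S. prefix n y = prefix n x" by blast
next
  assume H: "\<forall>n. \<exists>y\<in>S. prefix n y = prefix n x"
  show "x \<in> seq_top closure_of S"
    unfolding in_closure_of
  proof (intro conjI allI impI)
    fix T assume T: "x \<in> T \<and> openin seq_top T"
    then obtain n where n: "\<forall>y. prefix n y = prefix n x \<longrightarrow> y \<in> T"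
      unfolding openin_seq_top_iff by blast
    obtain y where "y \<in> S" "prefix n y = prefix n x" using H by blast
    with n show "\<exists>y. y \<in> S \<and> y \<in> T" by (intro exI[of _ y]) simp
  qed simp
qed

lemma compactin_seq_top:
  assumes "closedin seq_top S" "finite F" "\<And>x n. x \<in> S \<Longrightarrow> x n \<in> F"
  shows "compactin seq_top S"
proof -
  have "compactin seq_top (\<Pi>\<^sub>E i\<in>UNIV. F)"
    unfolding seq_top_def by (subst compactin_PiE) (auto simp: compactin_discrete_topology assms)
  moreover have "S \<subseteq> (\<Pi>\<^sub>E i\<in>UNIV. F)" using assms(3) by auto
  ultimately show ?thesis using assms(1) closed_compactin by blast
qed

lemma compactin_seq_top_closedin: "compactin seq_top S \<Longrightarrow> closedin seq_top S"
  by (rule compactin_imp_closedin[OF Hausdorff_seq_top])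

lemma continuous_map_seq_top:
  assumes "\<And>n. \<exists>m. \<forall>x y. prefix m x = prefix m y \<longrightarrow> prefix n (F x) = prefix n (F y)"
  shows "continuous_map seq_top seq_top F"
  unfolding continuous_map_def
proof (intro conjI allI impI)
  fix U :: "(nat \<Rightarrow> 'b) set" assume U: "openin seq_top U"
  show "openin seq_top {x \<in> topspace seq_top. F x \<in> U}"
    unfolding openin_seq_top_iff
  proof
    fix x assume "x \<in> {x \<in> topspace seq_top. F x \<in> U}"
    then obtain n where n: "\<forall>y. prefix n y = prefix n (F x) \<longrightarrow> y \<in> U"
      using U unfolding openin_seq_top_iff by auto
    obtain m where m: "\<forall>x y. prefix m x = prefix m y \<longrightarrow> prefix n (F x) = prefix n (F y)"
      using assms[of n] by (elim exE)
    have "F y \<in> U" if "prefix m y = prefix m x" for y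
      using n m[rule_format, OF that] by (elim allE[of _ "F y"]) (rule mp)
    then show "\<exists>n. \<forall>y. prefix n y = prefix n x \<longrightarrow> y \<in> {x \<in> topspace seq_top. F x \<in> U}"
      unfolding topspace_seq_top by (intro exI[of _ m]) blast
  qed
qed auto

lemma continuous_map_suffix_seq_img:
  assumes "nonerasing f"
  shows "continuous_map seq_top seq_top (\<lambda>z. suffix i (seq_img f z))"
proof (rule continuous_map_seq_top)
  fix n
  show "\<exists>m. \<forall>x y. prefix m x = prefix m y \<longrightarrow> prefix n (suffix i (seq_img f x)) = prefix n (suffix i (seq_img f y))"
    using prefix_seq_img_agree'[OF assms] prefix_suffix_eq by (intro exI[of _ "i + n"]) blast
qed

lemma continuous_map_suffix: "continuous_map seq_top seq_top (suffix i)"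
  by (rule continuous_map_seq_top) (metis prefix_suffix_eq)

section \<open>Towers over a stationary sequence of bases\<close>

text \<open>This is a Kakutani-Rokhlin partition of \<open>Y\<close>: the base is the image of
  \<open>Z\<close>, split by first letters, and the tower over the letter \<open>v\<close> has
  \<open>length (f v)\<close> floors. Using codes instead of points of the base lets the same
  \<open>Z\<close> occur at all levels.\<close>

definition tower_partition ::
  "(nat \<Rightarrow> 'b list) \<Rightarrow> (nat \<Rightarrow> nat) set \<Rightarrow> (nat \<Rightarrow> 'b) set \<Rightarrow> bool" where
  "tower_partition f Z Y \<longleftrightarrow>
     (\<forall>z\<in>Z. \<forall>i < length (f (z 0)). suffix i (seq_img f z) \<in> Y) \<and>
     (\<forall>y\<in>Y. \<exists>z\<in>Z. \<exists>i < length (f (z 0)). y = suffix i (seq_img f z)) \<and>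
     (\<forall>z\<in>Z. \<forall>z'\<in>Z. \<forall>i < length (f (z 0)). \<forall>i' < length (f (z' 0)).
        suffix i (seq_img f z) = suffix i' (seq_img f z') \<longrightarrow> z = z' \<and> i = i')"

definition tower_coords ::
  "(nat \<Rightarrow> 'b list) \<Rightarrow> (nat \<Rightarrow> nat) set \<Rightarrow> (nat \<Rightarrow> 'b) \<Rightarrow> (nat \<Rightarrow> nat) \<times> nat" where
  "tower_coords f Z y =
     (SOME p. fst p \<in> Z \<and> snd p < length (f (fst p 0)) \<and> y = suffix (snd p) (seq_img f (fst p)))"

abbreviation "base f Z y \<equiv> fst (tower_coords f Z y)"
abbreviation "height f Z y \<equiv> snd (tower_coords f Z y)"

lemma tower_coords:
  assumes "tower_partition f Z Y" "y \<in> Y"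
  shows "base f Z y \<in> Z" "height f Z y < length (f (base f Z y 0))"
    "y = suffix (height f Z y) (seq_img f (base f Z y))"
proof -
  have "\<exists>p. fst p \<in> Z \<and> snd p < length (f (fst p 0)) \<and> y = suffix (snd p) (seq_img f (fst p))"
    using assms unfolding tower_partition_def by fastforce
  from someI_ex[OF this, folded tower_coords_def] show "base f Z y \<in> Z"
    "height f Z y < length (f (base f Z y 0))"
    "y = suffix (height f Z y) (seq_img f (base f Z y))" by blast+
qed

lemma tower_partition_in:
  "tower_partition f Z Y \<Longrightarrow> z \<in> Z \<Longrightarrow> i < length (f (z 0)) \<Longrightarrow> suffix i (seq_img f z) \<in> Y"
  unfolding tower_partition_def by blast

lemma tower_partition_unique:
  assumes "tower_partition f Z Y" "z \<in> Z" "z' \<in> Z" "i < length (f (z 0))" "i' < length (f (z' 0))"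
    "suffix i (seq_img f z) = suffix i' (seq_img f z')"
  shows "z = z'" "i = i'"
  using assms unfolding tower_partition_def by blast+

lemma tower_coords_eq:
  assumes "tower_partition f Z Y" "z \<in> Z" "i < length (f (z 0))"
  shows "base f Z (suffix i (seq_img f z)) = z" "height f Z (suffix i (seq_img f z)) = i"
proof -
  note t = tower_coords[OF assms(1) tower_partition_in[OF assms]]
  from tower_partition_unique[OF assms(1) t(1) assms(2) t(2) assms(3) t(3)[symmetric]]
  show "base f Z (suffix i (seq_img f z)) = z" "height f Z (suffix i (seq_img f z)) = i"
    by simp_all
qed

text \<open>The set is a finite union of continuous images of compact sets. Since \<open>A\<close>
  may depend on the height, both coordinates are covered: a constant family gives continuity of the
  base, a family with values \<open>Z\<close> and the empty set that of the height.\<close>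

lemma closedin_tower_coords:
  assumes ne: "nonerasing f" and fin: "finite V" and V: "\<And>z. z \<in> Z \<Longrightarrow> z 0 \<in> V"
    and t: "tower_partition f Z Y"
    and A: "\<And>i. compactin seq_top (A i)" "\<And>i. A i \<subseteq> Z"
  shows "closedin (subtopology seq_top Y) {y \<in> Y. base f Z y \<in> A (height f Z y)}"
proof (rule closedin_subset_topspace)
  let ?B = "\<lambda>v i. (\<lambda>z. suffix i (seq_img f z)) ` (A i \<inter> {z. z 0 = v})"
  have eq: "{y \<in> Y. base f Z y \<in> A (height f Z y)} = (\<Union>v\<in>V. \<Union>i\<in>{..<length (f v)}. ?B v i)"
  proof (intro equalityI subsetI)
    fix y assume y: "y \<in> {y \<in> Y. base f Z y \<in> A (height f Z y)}"
    then have "y \<in> Y" by simp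
    note c = tower_coords[OF t this]
    have "y \<in> ?B (base f Z y 0) (height f Z y)" using c(3) y by blast
    then show "y \<in> (\<Union>v\<in>V. \<Union>i\<in>{..<length (f v)}. ?B v i)"
      using c(2) V[OF c(1)] by blast
  next
    fix y assume "y \<in> (\<Union>v\<in>V. \<Union>i\<in>{..<length (f v)}. ?B v i)"
    then obtain z i where z: "i < length (f (z 0))" "z \<in> A i" "y = suffix i (seq_img f z)" by blast
    then have "z \<in> Z" using A(2) by blast
    with z show "y \<in> {y \<in> Y. base f Z y \<in> A (height f Z y)}"
      using tower_coords_eq[OF t] tower_partition_in[OF t] by simp
  qed
  have cyl: "closedin seq_top {z :: nat \<Rightarrow> nat. z 0 = v}" for v
    unfolding closedin_seq_top_iff
  proof (intro allI impI)
    fix x :: "nat \<Rightarrow> nat" assume "\<forall>n. \<exists>y\<in>{z. z 0 = v}. prefix n y = prefix n x"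
    from this[rule_format, of 1] show "x \<in> {z. z 0 = v}" by auto
  qed
  have "closedin seq_top (?B v i)" for v i
    by (intro compactin_seq_top_closedin image_compactin[OF _ continuous_map_suffix_seq_img[OF ne]]
        compact_Int_closedin A cyl)
  then have "closedin seq_top (\<Union>v\<in>V. \<Union>i\<in>{..<length (f v)}. ?B v i)"
    using fin by (intro closedin_Union finite_imageI) (blast intro!: closedin_Union)+
  then show "closedin seq_top {y \<in> Y. base f Z y \<in> A (height f Z y)}" by (simp only: eq)
qed auto

lemma continuous_map_base:
  assumes "nonerasing f" "finite V" "\<And>z. z \<in> Z \<Longrightarrow> z 0 \<in> V" "tower_partition f Z Y"
    and Z: "compactin seq_top Z"
  shows "continuous_map (subtopology seq_top Y) (subtopology seq_top Z) (base f Z)"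
  unfolding continuous_map_closedin topspace_subtopology topspace_seq_top Int_UNIV_left
proof (intro conjI allI impI)
  show "base f Z \<in> Y \<rightarrow> Z" using tower_coords(1)[OF assms(4)] by blast
  fix C assume "closedin (subtopology seq_top Z) C"
  then obtain T where "closedin seq_top T" "C = T \<inter> Z" by (auto simp: closedin_subtopology)
  then have "compactin seq_top C" "C \<subseteq> Z" using Z by (auto intro: closed_Int_compactin)
  then show "closedin (subtopology seq_top Y) {y \<in> Y. base f Z y \<in> C}"
    by (intro closedin_tower_coords[where A = "\<lambda>_. C" and V = V] assms)
qed

lemma continuous_map_height:
  assumes "nonerasing f" "finite V" "\<And>z. z \<in> Z \<Longrightarrow> z 0 \<in> V" "tower_partition f Z Y"
    and Z: "compactin seq_top Z"
  shows "continuous_map (subtopology seq_top Y) (discrete_topology UNIV) (height f Z)"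
  unfolding continuous_map_closedin topspace_subtopology topspace_seq_top Int_UNIV_left
proof (intro conjI allI impI)
  fix C
  have "{y \<in> Y. height f Z y \<in> C} = {y \<in> Y. base f Z y \<in> (if height f Z y \<in> C then Z else {})}"
    using tower_coords(1)[OF assms(4)] by auto
  moreover have "closedin (subtopology seq_top Y)
      {y \<in> Y. base f Z y \<in> (\<lambda>i. if i \<in> C then Z else {}) (height f Z y)}"
    by (rule closedin_tower_coords[where V = V]) (auto simp: assms)
  ultimately show "closedin (subtopology seq_top Y) {y \<in> Y. height f Z y \<in> C}" by simp
qed simp

lemma suffix_last_seq_img:
  assumes "nonerasing f" "i = length (f (z 0)) - 1"
  shows "suffix 1 (suffix i (seq_img f z)) = seq_img f (suffix 1 z)"
  using suffix_seq_img[OF assms(1), of z 1] nonerasing_length[OF assms(1), of "z 0"] assms(2) by simp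

text \<open>Stationarity is expressed by \<open>part_\<theta>\<close>, where \<open>Z\<close> is
  partitioned over itself. \<open>separation\<close> says that points in the bases of high levels
  have long common prefixes; it makes the coding injective. \<open>fixed_point\<close> supplies a
  minimal path.\<close>

locale stationary_towers =
  fixes V :: "nat set" and \<theta> :: "nat \<Rightarrow> nat list" and \<kappa> :: "nat \<Rightarrow> 'b list"
    and Z :: "(nat \<Rightarrow> nat) set" and X :: "(nat \<Rightarrow> 'b) set"
  assumes finite_V: "finite V"
    and ne_\<theta>: "nonerasing \<theta>" and ne_\<kappa>: "nonerasing \<kappa>"
    and compact_Z: "compactin seq_top Z" and compact_X: "compactin seq_top X"
    and letters: "\<And>z n. z \<in> Z \<Longrightarrow> z n \<in> V"
    and occurs: "\<And>v. v \<in> V \<Longrightarrow> \<exists>z\<in>Z. z 0 = v"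
    and suffix_Z: "\<And>z. z \<in> Z \<Longrightarrow> suffix 1 z \<in> Z"
    and part_\<kappa>: "tower_partition \<kappa> Z X" and part_\<theta>: "tower_partition \<theta> Z Z"
    and separation: "\<And>N. \<exists>n. \<forall>z\<in>Z. \<forall>z'\<in>Z.
      prefix N (seq_img \<kappa> ((seq_img \<theta> ^^ n) z)) = prefix N (seq_img \<kappa> ((seq_img \<theta> ^^ n) z'))"
    and fixed_point: "\<exists>z\<in>Z. seq_img \<theta> z = z"
begin

section \<open>Addresses of points\<close>

text \<open>Here \<open>zs n\<close> is the code of the base point below \<open>y\<close> at level
  \<open>n\<close>. A relation is used because a step of the Vershik map can then be checked by
  exhibiting the base points of the shifted point.\<close>

definition codes :: "(nat \<Rightarrow> nat \<times> nat) \<Rightarrow> (nat \<Rightarrow> 'b) \<Rightarrow> (nat \<Rightarrow> nat \<Rightarrow> nat) \<Rightarrow> bool" where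
  "codes x y zs \<longleftrightarrow> (\<forall>n. zs n \<in> Z \<and> fst (x n) = zs n 0) \<and>
     snd (x 0) < length (\<kappa> (zs 0 0)) \<and> y = suffix (snd (x 0)) (seq_img \<kappa> (zs 0)) \<and>
     (\<forall>n. snd (x (Suc n)) < length (\<theta> (zs (Suc n) 0)) \<and>
          zs n = suffix (snd (x (Suc n))) (seq_img \<theta> (zs (Suc n))))"

lemma codesD:
  assumes "codes x y zs"
  shows "zs n \<in> Z" "fst (x n) = zs n 0"
    "snd (x 0) < length (\<kappa> (zs 0 0))" "y = suffix (snd (x 0)) (seq_img \<kappa> (zs 0))"
    "snd (x (Suc n)) < length (\<theta> (zs (Suc n) 0))"
    "zs n = suffix (snd (x (Suc n))) (seq_img \<theta> (zs (Suc n)))"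
  using assms unfolding codes_def by blast+

lemma codesI:
  assumes "\<And>n. zs n \<in> Z" "\<And>n. fst (x n) = zs n 0"
    "snd (x 0) < length (\<kappa> (zs 0 0))" "y = suffix (snd (x 0)) (seq_img \<kappa> (zs 0))"
    "\<And>n. snd (x (Suc n)) < length (\<theta> (zs (Suc n) 0))"
    "\<And>n. zs n = suffix (snd (x (Suc n))) (seq_img \<theta> (zs (Suc n)))"
  shows "codes x y zs"
  using assms unfolding codes_def by blast

definition level :: "(nat \<Rightarrow> 'b) \<Rightarrow> nat \<Rightarrow> nat \<Rightarrow> nat" where
  "level y n = (base \<theta> Z ^^ n) (base \<kappa> Z y)"

definition path_of :: "(nat \<Rightarrow> 'b) \<Rightarrow> nat \<Rightarrow> nat \<times> nat" where
  "path_of y n = (level y n 0, case n of 0 \<Rightarrow> height \<kappa> Z y | Suc m \<Rightarrow> height \<theta> Z (level y m))"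

abbreviation "paths \<equiv> path_space V (\<lambda>v. length (\<kappa> v)) \<theta>"
abbreviation "vmap \<equiv> vershik V (\<lambda>v. length (\<kappa> v)) \<theta>"

lemma level_in: "y \<in> X \<Longrightarrow> level y n \<in> Z"
  by (induction n) (auto simp: level_def intro: tower_coords(1)[OF part_\<kappa>] tower_coords(1)[OF part_\<theta>])

lemma codes_path:
  assumes "y \<in> X"
  shows "codes (path_of y) y (level y)"
proof -
  have l: "level y (Suc n) = base \<theta> Z (level y n)" "level y 0 = base \<kappa> Z y" for n
    by (simp_all add: level_def)
  have p: "fst (path_of y n) = level y n 0" "snd (path_of y 0) = height \<kappa> Z y"
    "snd (path_of y (Suc n)) = height \<theta> Z (level y n)" for n by (simp_all add: path_of_def)
  show ?thesis
    by (rule codesI; (unfold p l)?)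
      (rule level_in[OF assms] refl tower_coords[OF part_\<kappa> assms]
        tower_coords[OF part_\<theta> level_in[OF assms]])+
qed

lemma codes_in_X: "codes x y zs \<Longrightarrow> y \<in> X"
  by (subst codesD(4)) (auto intro: tower_partition_in[OF part_\<kappa>] dest: codesD(1,3))

text \<open>Floors of a tower partition are disjoint, so base point and edge are forced level by
  level.\<close>

lemma codes_unique:
  assumes "codes x y zs"
  shows "x = path_of y" "zs = level y"
proof -
  have zs: "zs n = level y n" for n
  proof (induction n)
    case 0
    show ?case
      using tower_coords_eq(1)[OF part_\<kappa> codesD(1,3)[OF assms]] codesD(4)[OF assms] unfolding level_def
      by (metis funpow_0)
  next
    case (Suc n)
    have "zs (Suc n) = base \<theta> Z (zs n)"
      using tower_coords_eq(1)[OF part_\<theta> codesD(1,5)[OF assms]] codesD(6)[OF assms, of n] by simp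
    with Suc show ?case by (simp add: level_def)
  qed
  then show zs': "zs = level y" by blast
  show "x = path_of y"
  proof
    fix n
    have "snd (x n) = snd (path_of y n)"
    proof (cases n)
      case 0
      then show ?thesis
        using tower_coords_eq(2)[OF part_\<kappa> codesD(1,3)[OF assms]] codesD(4)[OF assms] by (simp add: path_of_def)
    next
      case (Suc m)
      have "snd (x (Suc m)) = height \<theta> Z (zs m)"
        using tower_coords_eq(2)[OF part_\<theta> codesD(1,5)[OF assms]] codesD(6)[OF assms, of m] by simp
      with Suc zs show ?thesis by (simp add: path_of_def)
    qed
    moreover have "fst (x n) = fst (path_of y n)" using codesD(2)[OF assms] zs by (simp add: path_of_def)
    ultimately show "x n = path_of y n" by (rule prod_eqI[rotated])
  qed
qed

lemma codes_path_space:
  assumes "codes x y zs"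
  shows "x \<in> paths"
proof -
  have "src \<theta> (x (Suc n)) = fst (x n)" for n
    using seq_img_0[OF ne_\<theta>, of "snd (x (Suc n))" "zs (Suc n)"] codesD(5)[OF assms, of n]
      arg_cong[OF codesD(6)[OF assms, of n], of "\<lambda>z. z 0"] codesD(2)[OF assms] by (simp add: src_def)
  then show ?thesis
    using codesD(2,3,5)[OF assms] letters[OF codesD(1)[OF assms]] unfolding path_space_def edges1_def edges2_def
    by (auto simp: case_prod_unfold)
qed

text \<open>The position \<open>J\<close> is computed from the path alone; the quantifiers are
  ordered so that it is the same for all points coded by \<open>x\<close>.\<close>

lemma codes_level:
  assumes "x \<in> paths"
  shows "\<exists>J < length (word_pow \<theta> m (fst (x m))).
    \<forall>y zs. codes x y zs \<longrightarrow> zs 0 = suffix J ((seq_img \<theta> ^^ m) (zs m))"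
proof (induction m)
  case (Suc m)
  then obtain J where J: "J < length (word_pow \<theta> m (fst (x m)))"
    "\<And>y zs. codes x y zs \<Longrightarrow> zs 0 = suffix J ((seq_img \<theta> ^^ m) (zs m))" by blast
  let ?g = "word_pow \<theta> m" and ?v = "fst (x (Suc m))" and ?i = "snd (x (Suc m))"
  have ne: "nonerasing ?g" using nonerasing_pow[OF ne_\<theta>] .
  have i: "?i < length (\<theta> ?v)" "\<theta> ?v ! ?i = fst (x m)"
    using assms by (auto simp: path_space_def edges2_def src_def case_prod_unfold)
  \<comment> \<open>Letters before the chosen edge contribute their whole \<open>m\<close>-fold
    images; \<open>J\<close> is the position inside the next one.\<close>
  define J' where "J' = length (word_img ?g (take ?i (\<theta> ?v))) + J"
  have "word_pow \<theta> (Suc m) ?v = word_img ?g (\<theta> ?v)"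
    by (simp add: funpow_Suc_right word_img_pow[symmetric] del: funpow.simps)
  moreover have "word_img ?g (\<theta> ?v) =
      word_img ?g (take ?i (\<theta> ?v)) @ ?g (fst (x m)) @ word_img ?g (drop (Suc ?i) (\<theta> ?v))"
    by (subst id_take_nth_drop[OF i(1)]) (simp add: i(2))
  ultimately have "J' < length (word_pow \<theta> (Suc m) ?v)" using J(1) by (simp add: J'_def)
  moreover have "zs 0 = suffix J' ((seq_img \<theta> ^^ Suc m) (zs (Suc m)))" if c: "codes x y zs" for y zs
  proof -
    let ?s = "seq_img \<theta> (zs (Suc m))"
    have v: "?v = zs (Suc m) 0" and m: "zs m = suffix ?i ?s" using codesD(2,6)[OF c] by blast+
    have "prefix ?i ?s = take ?i (\<theta> ?v)"
      using seq_img_split_first[OF ne_\<theta>, of "zs (Suc m)"] i(1) v by simp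
    then have "suffix (length (word_img ?g (take ?i (\<theta> ?v)))) (seq_img ?g ?s) = seq_img ?g (zs m)"
      using suffix_seq_img[OF ne, of ?s ?i] m by simp
    moreover have "seq_img ?g ?s = (seq_img \<theta> ^^ Suc m) (zs (Suc m))"
      by (simp add: funpow_Suc_right seq_img_pow[OF ne_\<theta>, symmetric] del: funpow.simps)
    ultimately have a: "seq_img ?g (zs m) =
        suffix (length (word_img ?g (take ?i (\<theta> ?v)))) ((seq_img \<theta> ^^ Suc m) (zs (Suc m)))" by (simp only:)
    have "zs 0 = suffix J (seq_img ?g (zs m))" using J(2)[OF c] seq_img_pow[OF ne_\<theta>, of m "zs m"] by (simp only:)
    then show ?thesis by (simp only: a suffix_suffix J'_def)
  qed
  ultimately show ?case by blast
qed auto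

text \<open>Up to level \<open>m\<close> the path fixes a word, the tower label spelled out by
  \<open>\<kappa>\<close>, and the position of \<open>y\<close> in it. The word is followed by
  another base point of level \<open>m\<close>, and by \<open>separation\<close> all of these share
  \<open>N\<close> letters. Hence \<open>N\<close> letters are determined even if \<open>y\<close>
  sits near the end of the word.\<close>

lemma codes_inj:
  assumes "codes x y zs" "codes x y' zs'"
  shows "y = y'"
proof (rule seq_eqI_prefix)
  fix N
  obtain m where m: "\<And>z z'. z \<in> Z \<Longrightarrow> z' \<in> Z \<Longrightarrow>
      prefix N (seq_img \<kappa> ((seq_img \<theta> ^^ m) z)) = prefix N (seq_img \<kappa> ((seq_img \<theta> ^^ m) z'))"
    using separation[of N] by blast
  let ?g = "word_pow \<theta> m" and ?v = "fst (x m)" and ?i = "snd (x 0)"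
  have ne: "nonerasing ?g" using nonerasing_pow[OF ne_\<theta>] .
  obtain J where J: "J < length (?g ?v)"
    "\<And>y zs. codes x y zs \<Longrightarrow> zs 0 = suffix J ((seq_img \<theta> ^^ m) (zs m))"
    using codes_level[OF codes_path_space[OF assms(1)], of m] by blast
  let ?T = "length (word_img \<kappa> (?g ?v))" and ?K = "length (word_img \<kappa> (take J (?g ?v))) + ?i"
  have *: "y = suffix ?K (word_img \<kappa> (?g ?v) \<frown> seq_img \<kappa> (seq_img ?g (suffix 1 (zs m))))"
    "?i < length (\<kappa> (?g ?v ! J))"
    if c: "codes x y zs" for y zs
  proof -
    let ?s = "seq_img ?g (zs m)"
    have s: "?s = ?g ?v \<frown> seq_img ?g (suffix 1 (zs m))"
      using seq_img_split_first[OF ne, of "zs m"] codesD(2)[OF c, of m] by simp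
    have zs0: "zs 0 = suffix J ?s" using J(2)[OF c] seq_img_pow[OF ne_\<theta>, of m "zs m"] by simp
    have p: "prefix J ?s = take J (?g ?v)" using J(1) by (subst s) simp
    have "seq_img \<kappa> (zs 0) = suffix (length (word_img \<kappa> (take J (?g ?v)))) (seq_img \<kappa> ?s)"
      using suffix_seq_img[OF ne_\<kappa>, of ?s J] p zs0 by simp
    then have "y = suffix ?K (seq_img \<kappa> ?s)" using codesD(4)[OF c] by simp
    then show "y = suffix ?K (word_img \<kappa> (?g ?v) \<frown> seq_img \<kappa> (seq_img ?g (suffix 1 (zs m))))"
      by (subst (asm) s) (simp add: seq_img_conc[OF ne_\<kappa>])
    have "zs 0 0 = ?g ?v ! J" using zs0 s J(1) by (metis add.right_neutral conc_fst suffix_nth)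
    then show "?i < length (\<kappa> (?g ?v ! J))" using codesD(3)[OF c] by simp
  qed
  have "word_img \<kappa> (?g ?v) =
      word_img \<kappa> (take J (?g ?v)) @ \<kappa> (?g ?v ! J) @ word_img \<kappa> (drop (Suc J) (?g ?v))"
    by (subst id_take_nth_drop[OF J(1)]) simp
  then have K: "?K \<le> ?T" using *(2)[OF assms(1)] by simp
  have "suffix 1 (zs m) \<in> Z" "suffix 1 (zs' m) \<in> Z" using assms suffix_Z codesD(1) by blast+
  then have "prefix N (seq_img \<kappa> (seq_img ?g (suffix 1 (zs m)))) =
      prefix N (seq_img \<kappa> (seq_img ?g (suffix 1 (zs' m))))"
    using m by (metis seq_img_pow[OF ne_\<theta>])
  then have "prefix (?T + N) (word_img \<kappa> (?g ?v) \<frown> seq_img \<kappa> (seq_img ?g (suffix 1 (zs m)))) =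
      prefix (?T + N) (word_img \<kappa> (?g ?v) \<frown> seq_img \<kappa> (seq_img ?g (suffix 1 (zs' m))))"
    by (simp only: prefix_conc_eq_iff)
  then have "prefix (?K + N) (word_img \<kappa> (?g ?v) \<frown> seq_img \<kappa> (seq_img ?g (suffix 1 (zs m)))) =
      prefix (?K + N) (word_img \<kappa> (?g ?v) \<frown> seq_img \<kappa> (seq_img ?g (suffix 1 (zs' m))))"
    by (rule prefix_mono_eq) (use K in simp)
  from prefix_suffix_eq[OF this] show "prefix N y = prefix N y'"
    by (simp only: *(1)[OF assms(1), symmetric] *(1)[OF assms(2), symmetric])
qed

section \<open>Every path is an address\<close>

text \<open>Any code with the right first letter may be chosen at level \<open>n\<close>; descending
  along the edges gives the lower ones. All levels look alike, so the induction drops the lowest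
  level of the path.\<close>

lemma partial_codes:
  assumes "\<And>n. fst (x n) \<in> V" "\<And>n. snd (x (Suc n)) < length (\<theta> (fst (x (Suc n))))"
    "\<And>n. \<theta> (fst (x (Suc n))) ! snd (x (Suc n)) = fst (x n)"
  shows "\<exists>zs. (\<forall>k\<le>n. zs k \<in> Z \<and> fst (x k) = zs k 0) \<and>
    (\<forall>k<n. zs k = suffix (snd (x (Suc k))) (seq_img \<theta> (zs (Suc k))))"
  using assms
proof (induction n arbitrary: x)
  case 0
  then obtain z where "z \<in> Z" "z 0 = fst (x 0)" using occurs by blast
  then show ?case by (intro exI[of _ "\<lambda>_. z"]) auto
next
  case (Suc n)
  from Suc.IH[of "\<lambda>n. x (Suc n)", OF Suc.prems(1) Suc.prems(2) Suc.prems(3)] obtain zs where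
    zs: "\<And>k. k \<le> n \<Longrightarrow> zs k \<in> Z \<and> fst (x (Suc k)) = zs k 0"
    "\<And>k. k < n \<Longrightarrow> zs k = suffix (snd (x (Suc (Suc k)))) (seq_img \<theta> (zs (Suc k)))" by blast
  let ?z = "suffix (snd (x (Suc 0))) (seq_img \<theta> (zs 0))"
  have "?z \<in> Z" using zs(1)[of 0] Suc.prems(2)[of 0] by (auto intro: tower_partition_in[OF part_\<theta>])
  moreover have "?z 0 = fst (x 0)"
    using zs(1)[of 0] Suc.prems(2,3)[of 0] seq_img_0[OF ne_\<theta>] by simp
  ultimately show ?case
    using zs by (intro exI[of _ "case_nat ?z zs"]) (auto split: nat.splits simp: less_Suc_eq_0_disj)
qed

lemma path_dense:
  assumes "x \<in> paths"
  shows "\<exists>y\<in>X. prefix n (path_of y) = prefix n x"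
proof -
  have x: "fst (x n) \<in> V" "snd (x (Suc n)) < length (\<theta> (fst (x (Suc n))))"
    "\<theta> (fst (x (Suc n))) ! snd (x (Suc n)) = fst (x n)" "snd (x 0) < length (\<kappa> (fst (x 0)))" for n
    using assms by (cases n; auto simp: path_space_def edges2_def edges1_def src_def case_prod_unfold)+
  obtain zs where zs: "\<And>k. k \<le> n \<Longrightarrow> zs k \<in> Z \<and> fst (x k) = zs k 0"
    "\<And>k. k < n \<Longrightarrow> zs k = suffix (snd (x (Suc k))) (seq_img \<theta> (zs (Suc k)))"
    using partial_codes[where x = x and n = n, OF x(1) x(2) x(3)] by blast
  define y where "y = suffix (snd (x 0)) (seq_img \<kappa> (zs 0))"
  have y: "y \<in> X" "base \<kappa> Z y = zs 0" "height \<kappa> Z y = snd (x 0)"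
    using zs(1)[of 0] x(4) tower_partition_in[OF part_\<kappa>, of "zs 0" "snd (x 0)"]
      tower_coords_eq[OF part_\<kappa>, of "zs 0" "snd (x 0)"] by (auto simp: y_def)
  have step: "base \<theta> Z (zs k) = zs (Suc k)" "height \<theta> Z (zs k) = snd (x (Suc k))" if "k < n" for k
    using that zs(2)[OF that] zs(1)[of "Suc k"] x(2)[of k]
      tower_coords_eq[OF part_\<theta>, of "zs (Suc k)" "snd (x (Suc k))"] by auto
  have l: "k \<le> n \<Longrightarrow> level y k = zs k" for k
    using y(2) step(1) by (induction k) (auto simp: level_def)
  have "path_of y k = x k" if "k < n" for k
    using that l zs(1)[of k] step(2) y(3) by (cases k) (auto simp: path_of_def prod_eq_iff)
  then show ?thesis using y(1) by (auto simp: prefix_eq_iff)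
qed

lemma path_continuous: "continuous_map (subtopology seq_top X) seq_top path_of"
proof -
  have b\<kappa>: "continuous_map (subtopology seq_top X) (subtopology seq_top Z) (base \<kappa> Z)"
    by (rule continuous_map_base[where V = V, OF ne_\<kappa> finite_V _ part_\<kappa> compact_Z]) (rule letters)
  have b\<theta>: "continuous_map (subtopology seq_top Z) (subtopology seq_top Z) (base \<theta> Z)"
    by (rule continuous_map_base[where V = V, OF ne_\<theta> finite_V _ part_\<theta> compact_Z]) (rule letters)
  have h\<kappa>: "continuous_map (subtopology seq_top X) (discrete_topology UNIV) (height \<kappa> Z)"
    by (rule continuous_map_height[where V = V, OF ne_\<kappa> finite_V _ part_\<kappa> compact_Z]) (rule letters)
  have h\<theta>: "continuous_map (subtopology seq_top Z) (discrete_topology UNIV) (height \<theta> Z)"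
    by (rule continuous_map_height[where V = V, OF ne_\<theta> finite_V _ part_\<theta> compact_Z]) (rule letters)
  have lev: "continuous_map (subtopology seq_top X) (subtopology seq_top Z) (\<lambda>y. level y n)" for n
  proof (induction n)
    case 0
    show ?case using b\<kappa> by (simp add: level_def)
  next
    case (Suc n)
    from continuous_map_compose[OF this b\<theta>] show ?case by (simp add: level_def o_def)
  qed
  have fst: "continuous_map (subtopology seq_top X) (discrete_topology UNIV) (\<lambda>y. level y n 0)" for n
  proof -
    have "continuous_map (subtopology seq_top Z) (discrete_topology UNIV) (\<lambda>z :: nat \<Rightarrow> nat. z 0)"
      unfolding seq_top_def
      by (intro continuous_map_from_subtopology continuous_map_product_projection) simp
    from continuous_map_compose[OF lev this] show ?thesis by (simp add: o_def)
  qed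
  have snd: "continuous_map (subtopology seq_top X) (discrete_topology UNIV) (\<lambda>y. snd (path_of y n))" for n
  proof (cases n)
    case 0
    then show ?thesis using h\<kappa> by (simp add: path_of_def)
  next
    case (Suc m)
    from continuous_map_compose[OF lev h\<theta>, of m] Suc show ?thesis by (simp add: path_of_def o_def)
  qed
  have "continuous_map (subtopology seq_top X)
      (prod_topology (discrete_topology UNIV) (discrete_topology UNIV)) (\<lambda>y. path_of y n)" for n
    using fst[of n] snd[of n] continuous_map_pairedI[OF fst[of n] snd[of n]] by (simp add: path_of_def)
  then show ?thesis
    unfolding seq_top_def[where 'a = "nat \<times> nat"] continuous_map_componentwise_UNIV
    by (simp flip: prod_topology_discrete_topology)
qed

lemma path_inj: "inj_on path_of X"
  using codes_path codes_inj by (intro inj_onI) metis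

text \<open>Addresses are dense among the paths and form a compact set, so it is enough to realize
  finite initial parts of a path.\<close>

lemma path_image: "path_of ` X = paths"
proof
  show "path_of ` X \<subseteq> paths" using codes_path codes_path_space by blast
  have "compactin seq_top (path_of ` X)"
    by (rule image_compactin[OF _ path_continuous]) (simp add: compactin_subtopology compact_X)
  then show "paths \<subseteq> path_of ` X"
    using path_dense by (intro subsetI closedin_seq_topD[OF compactin_seq_top_closedin]) blast+
qed

lemma homeomorphic_path:
  "homeomorphic_map (subtopology seq_top X) (subtopology seq_top paths) path_of"
proof (rule bijective_closed_imp_homeomorphic_map)
  show c: "continuous_map (subtopology seq_top X) (subtopology seq_top paths) path_of"
    using path_continuous path_image by (auto simp: continuous_map_in_subtopology)
  show "closed_map (subtopology seq_top X) (subtopology seq_top paths) path_of"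
    by (rule continuous_imp_closed_map[OF c])
      (auto intro: compact_space_subtopology compact_X Hausdorff_space_subtopology Hausdorff_seq_top)
qed (auto simp: path_image path_inj)

text \<open>A point with a minimal path lies in the bases of all levels, and by
  \<open>separation\<close> two such points share all prefixes.\<close>

lemma min_path_unique: "\<exists>!m. m \<in> paths \<and> min_path m"
proof -
  obtain z where z: "z \<in> Z" "seq_img \<theta> z = z" using fixed_point by blast
  \<comment> \<open>A fixed point of \<open>\<theta>\<close> is its own base point at every
    level.\<close>
  have "codes (\<lambda>_. (z 0, 0)) (seq_img \<kappa> z) (\<lambda>_. z)"
    using z nonerasing_length[OF ne_\<theta>] nonerasing_length[OF ne_\<kappa>] by (simp add: codes_def)
  from codes_path_space[OF this] have ex: "(\<lambda>_. (z 0, 0)) \<in> paths" .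
  have "path_of y = path_of y'" if "y \<in> X" "y' \<in> X" "min_path (path_of y)" "min_path (path_of y')" for y y'
  proof -
    have pow: "y = seq_img \<kappa> ((seq_img \<theta> ^^ n) (level y n))" if "y \<in> X" "min_path (path_of y)" for y n
    proof -
      have "level y 0 = (seq_img \<theta> ^^ n) (level y n)"
      proof (induction n)
        case (Suc n)
        have "level y n = seq_img \<theta> (level y (Suc n))"
          using codesD(6)[OF codes_path[OF that(1)], of n] that(2) by (simp add: min_path_def)
        with Suc show ?case by (simp add: funpow_Suc_right del: funpow.simps)
      qed simp
      then show ?thesis using codesD(4)[OF codes_path[OF that(1)]] that(2) by (simp add: min_path_def)
    qed
    have "y = y'"
    proof (rule seq_eqI_prefix)
      fix N
      obtain n where "\<And>z z'. z \<in> Z \<Longrightarrow> z' \<in> Z \<Longrightarrow>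
          prefix N (seq_img \<kappa> ((seq_img \<theta> ^^ n) z)) = prefix N (seq_img \<kappa> ((seq_img \<theta> ^^ n) z'))"
        using separation[of N] by blast
      from this[OF level_in level_in, OF that(1,2)] show "prefix N y = prefix N y'"
        using pow[OF that(1,3)] pow[OF that(2,4)] by metis
    qed
    then show ?thesis by simp
  qed
  note unique = this
  have "min_path (\<lambda>_. (z 0, 0))" by (simp add: min_path_def)
  moreover have "m = (\<lambda>_. (z 0, 0))" if m: "m \<in> paths \<and> min_path m" for m
  proof -
    obtain y y' where "y \<in> X" "m = path_of y" "y' \<in> X" "(\<lambda>_. (z 0, 0)) = path_of y'"
      using m ex unfolding path_image[symmetric] by blast
    then show ?thesis using unique[of y y'] m \<open>min_path (\<lambda>_. (z 0, 0))\<close> by simp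
  qed
  ultimately show ?thesis using ex by blast
qed

section \<open>The Vershik map on addresses\<close>

text \<open>A point on the top floor at every level is shifted to the bottom floor at every level,
  over the base points \<open>suffix 1 (zs n)\<close>. The result is the minimal path whichever
  maximal path was given; this accommodates several preimages of one point.\<close>

lemma codes_max:
  assumes c: "codes x y zs" and m: "max_path (\<lambda>v. length (\<kappa> v)) \<theta> x"
  shows "vmap x = path_of (shift y)" "shift y \<in> X"
proof -
  have x: "snd (x (Suc n)) = length (\<theta> (zs (Suc n) 0)) - 1" "snd (x 0) = length (\<kappa> (zs 0 0)) - 1" for n
    using m[unfolded max_path_def, rule_format, of "Suc n"] m[unfolded max_path_def, rule_format, of 0]
      codesD(2)[OF c] by (simp_all add: max_edge_def)
  have sy: "shift y = seq_img \<kappa> (suffix 1 (zs 0))"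
    unfolding shift_eq_suffix by (subst codesD(4)[OF c], rule suffix_last_seq_img[OF ne_\<kappa>], rule x(2))
  have sl: "suffix 1 (zs n) = seq_img \<theta> (suffix 1 (zs (Suc n)))" for n
    by (subst codesD(6)[OF c, of n], rule suffix_last_seq_img[OF ne_\<theta>], rule x(1))
  have c': "codes (\<lambda>n. (zs n 1, 0)) (shift y) (\<lambda>n. suffix 1 (zs n))"
    by (rule codesI; (unfold snd_conv fst_conv suffix_0)?)
      (rule sy sl suffix_Z[OF codesD(1)[OF c]] nonerasing_length[OF ne_\<theta>] nonerasing_length[OF ne_\<kappa>] |
        simp)+
  then have p: "path_of (shift y) = (\<lambda>n. (zs n 1, 0))" "(\<lambda>n. (zs n 1, 0)) \<in> paths"
    using codes_unique(1)[OF c'] codes_path_space[OF c'] by simp_all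
  have "(THE m. m \<in> paths \<and> min_path m) = (\<lambda>n. (zs n 1, 0))"
    using min_path_unique p(2) by (intro the1_equality) (auto simp: min_path_def)
  then show "vmap x = path_of (shift y)" using m p(1) by (simp add: vershik_def)
  show "shift y \<in> X" by (rule codes_in_X[OF c'])
qed

text \<open>Below the first non-maximal level \<open>m\<close> the shift enters the next tower, so
  base points advance by one letter; at level \<open>m\<close> it climbs one floor; above
  \<open>m\<close> only the old coordinates remain.\<close>

lemma codes_not_max:
  assumes c: "codes x y zs" and nm: "\<not> max_path (\<lambda>v. length (\<kappa> v)) \<theta> x"
  shows "vmap x = path_of (shift y)" "shift y \<in> X"
proof -
  let ?me = "\<lambda>n. max_edge (\<lambda>v. length (\<kappa> v)) \<theta> n (x n)"
  define m where "m = (LEAST n. \<not> ?me n)"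
  have m: "\<not> ?me m" "\<And>n. n < m \<Longrightarrow> ?me n"
    unfolding m_def by (rule LeastI_ex) (use nm max_path_def in blast, use not_less_Least in blast)
  define zs' where "zs' n = (if n < m then suffix 1 (zs n) else zs n)" for n
  define x' where "x' n = (if n < m then (zs n 1, 0) else if n = m then (fst (x m), snd (x m) + 1) else x n)" for n
  have zsZ: "zs n \<in> Z" and fst: "fst (x n) = zs n 0" for n using codesD(1,2)[OF c] by blast+
  have lev: "snd (x (Suc n)) < length (\<theta> (zs (Suc n) 0))"
    "zs n = suffix (snd (x (Suc n))) (seq_img \<theta> (zs (Suc n)))" for n using codesD(5,6)[OF c] by blast+
  have bot: "snd (x 0) < length (\<kappa> (zs 0 0))" "y = suffix (snd (x 0)) (seq_img \<kappa> (zs 0))"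
    using codesD(3,4)[OF c] by blast+
  have bot': "snd (x' 0) < length (\<kappa> (zs' 0 0)) \<and> shift y = suffix (snd (x' 0)) (seq_img \<kappa> (zs' 0))"
  proof (cases "m = 0")
    case True
    then show ?thesis using m(1) bot fst[of 0]
      by (auto simp: x'_def zs'_def max_edge_def shift_eq_suffix add.commute)
  next
    case False
    then have "snd (x 0) = length (\<kappa> (zs 0 0)) - 1" using m(2)[of 0] fst[of 0] by (simp add: max_edge_def)
    from suffix_last_seq_img[where z = "zs 0", OF ne_\<kappa> this] show ?thesis
      using False bot(2) nonerasing_length[OF ne_\<kappa>] by (simp add: x'_def zs'_def shift_eq_suffix)
  qed
  have lev': "snd (x' (Suc n)) < length (\<theta> (zs' (Suc n) 0)) \<and>
      zs' n = suffix (snd (x' (Suc n))) (seq_img \<theta> (zs' (Suc n)))" for n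
  proof -
    consider "Suc n < m" | "m = Suc n" | "m \<le> n" by linarith
    then show ?thesis
    proof cases
      case 1
      then have "snd (x (Suc n)) = length (\<theta> (zs (Suc n) 0)) - 1"
        using m(2)[of "Suc n"] fst[of "Suc n"] by (simp add: max_edge_def)
      from suffix_last_seq_img[where z = "zs (Suc n)", OF ne_\<theta> this] show ?thesis
        using 1 lev(2)[of n] nonerasing_length[OF ne_\<theta>] by (simp add: x'_def zs'_def)
    next
      case 2
      have "zs' n = suffix 1 (suffix (snd (x (Suc n))) (seq_img \<theta> (zs (Suc n))))"
        using 2 lev(2)[of n] by (simp add: zs'_def)
      then show ?thesis using 2 m(1) lev(1)[of n] fst[of "Suc n"]
        by (auto simp: x'_def zs'_def max_edge_def)
    next
      case 3
      then show ?thesis using lev[of n] by (simp add: x'_def zs'_def)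
    qed
  qed
  have c': "codes x' (shift y) zs'"
  proof (rule codesI)
    show "zs' n \<in> Z" "fst (x' n) = zs' n 0" for n
      using zsZ suffix_Z fst by (simp_all add: x'_def zs'_def)
  qed (use bot' lev' in blast)+
  then have p: "path_of (shift y) = x'" using codes_unique(1) by metis
  \<comment> \<open>Minimal edges lead to first letters of images, and these are the second letters
    \<open>zs n 1\<close> of the old base points. Level \<open>m - 1\<close> already carries the
    source of the successor edge, so \<open>m - 1 - n\<close> descents remain.\<close>
  have down: "((\<lambda>v. hd (\<theta> v)) ^^ d) (src \<theta> (fst (x m), snd (x m) + 1)) = zs n 1"
    if "n + Suc d = m" for n d
    using that
  proof (induction d arbitrary: n)
    case 0
    then have "zs n 1 = seq_img \<theta> (zs m) (snd (x m) + 1)" using lev(2)[of n] by (metis add.commute add_Suc_right add_0 suffix_nth)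
    moreover have "snd (x m) + 1 < length (\<theta> (zs m 0))"
      using m(1) 0 lev(1)[of n] fst[of m] by (auto simp: max_edge_def)
    ultimately show ?case using seq_img_0[OF ne_\<theta>, of "snd (x m) + 1" "zs m"] fst[of m] by (simp add: src_def)
  next
    case (Suc d)
    from Suc.prems lev'[of n] have "suffix 1 (zs n) = seq_img \<theta> (suffix 1 (zs (Suc n)))"
      by (simp add: x'_def zs'_def)
    then have "zs n 1 = seq_img \<theta> (suffix 1 (zs (Suc n))) 0" by (metis add.right_neutral suffix_nth)
    also have "\<dots> = hd (\<theta> (zs (Suc n) 1))"
      using seq_img_0[OF ne_\<theta>, of 0 "suffix 1 (zs (Suc n))"] nonerasing_length[OF ne_\<theta>, of "zs (Suc n) 1"]
      by (simp add: hd_conv_nth)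
    finally show ?case using Suc.IH[of "Suc n"] Suc.prems by simp
  qed
  have "vmap x = x'"
  proof
    fix n
    show "vmap x n = x' n"
      using nm down[of n "m - 1 - n"] by (simp add: vershik_def Let_def m_def[symmetric] x'_def)
  qed
  then show "vmap x = path_of (shift y)" using p by simp
  show "shift y \<in> X" by (rule codes_in_X[OF c'])
qed

theorem top_conjugate_paths:
  "top_conjugate (subtopology seq_top paths) vmap (subtopology seq_top X) shift"
proof -
  obtain h where h: "homeomorphic_maps (subtopology seq_top X) (subtopology seq_top paths) path_of h"
    using homeomorphic_path unfolding homeomorphic_map_maps by blast
  have hom: "homeomorphic_map (subtopology seq_top paths) (subtopology seq_top X) h"
    by (rule homeomorphic_maps_imp_map[OF iffD1[OF homeomorphic_maps_sym h]])
  have hp: "h (path_of y) = y" if "y \<in> X" for y using h that by (simp add: homeomorphic_maps_def)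
  have "h (vmap x) = shift (h x)" if x: "x \<in> paths" for x
  proof -
    obtain y where y: "y \<in> X" "x = path_of y" using x unfolding path_image[symmetric] by blast
    have c: "codes x y (level y)" using codes_path[OF y(1)] by (simp only: y(2))
    have *: "vmap x = path_of (shift y)" "shift y \<in> X"
      by (cases "max_path (\<lambda>v. length (\<kappa> v)) \<theta> x"; rule codes_max[OF c] codes_not_max[OF c]; assumption)+
    have "h (vmap x) = shift y" by (simp only: *(1) hp[OF *(2)])
    then show ?thesis by (simp only: y(2) hp[OF y(1)])
  qed
  then show ?thesis unfolding top_conjugate_def using hom by auto
qed

end

declare subsequence_shift [simp del] subseq_to_Suc [simp del] suffix_nth [simp del]

section \<open>Primitivity through iterated words, and block boundaries\<close>

lemma incidence_pow_pos_iff: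
  assumes "finite V" "\<And>v. v \<in> V \<Longrightarrow> set (\<theta> v) \<subseteq> V" "a \<in> V"
  shows "incidence_pow V \<theta> p a b > 0 \<longleftrightarrow> b \<in> set (word_pow \<theta> p a)"
proof -
  have sub: "set (word_pow \<theta> p a) \<subseteq> V" for p
  proof (induction p)
    case (Suc p)
    have "set (word_pow \<theta> (Suc p) a) = (\<Union>c\<in>set (word_pow \<theta> p a). set (\<theta> c))" by simp
    with Suc show ?case using assms(2) by blast
  qed (simp add: assms(3))
  show ?thesis
  proof (induction p arbitrary: b)
    case (Suc p)
    have "incidence_pow V \<theta> (Suc p) a b = 0 \<longleftrightarrow>
        (\<forall>c\<in>V. incidence_pow V \<theta> p a c = 0 \<or> b \<notin> set (\<theta> c))"
      using assms(1) by (simp add: incidence_def count_list_0_iff)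
    then have "incidence_pow V \<theta> (Suc p) a b > 0 \<longleftrightarrow>
        (\<exists>c\<in>V. incidence_pow V \<theta> p a c > 0 \<and> b \<in> set (\<theta> c))"
      by (metis gr0I less_irrefl)
    also have "\<dots> \<longleftrightarrow> b \<in> set (word_pow \<theta> (Suc p) a)" using Suc sub[of p] by auto
    finally show ?case .
  qed auto
qed

lemma primitive_on_iff:
  assumes "finite V" "\<And>v. v \<in> V \<Longrightarrow> set (\<theta> v) \<subseteq> V"
  shows "primitive_on V \<theta> \<longleftrightarrow> (\<exists>p\<ge>1. \<forall>a\<in>V. \<forall>b\<in>V. b \<in> set (word_pow \<theta> p a))"
  unfolding primitive_on_def using incidence_pow_pos_iff[OF assms] by auto

text \<open>The position at which the block of \<open>x q\<close> begins. For
  \<open>f = \<tau>\<close> and \<open>x = u\<close> these are the elements of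
  \<open>cut_set\<close>.\<close>

abbreviation cut :: "('v \<Rightarrow> 'b list) \<Rightarrow> (nat \<Rightarrow> 'v) \<Rightarrow> nat \<Rightarrow> nat" where
  "cut f x q \<equiv> length (word_img f (prefix q x))"

lemma prefix_add: "prefix (p + q) x = prefix p x @ prefix q (suffix p x)"
  by (simp add: subsequence_append subsequence_shift)

lemma cut_add: "cut f x (p + q) = cut f x p + cut f (suffix p x) q"
  by (simp add: prefix_add)

lemma cut_ge: "nonerasing f \<Longrightarrow> q \<le> cut f x q"
  using length_word_img_ge[of f "prefix q x"] by simp

lemma cut_less_cancel: "cut f x p < cut f x q \<Longrightarrow> p < q"
  using length_word_img_prefix_mono[of q p f x] by (meson not_le)

lemma cut_inject: "nonerasing f \<Longrightarrow> cut f x p = cut f x q \<Longrightarrow> p = q"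
  by (metis length_word_img_prefix_strict_mono linorder_neqE_nat order_less_irrefl)

lemma cut_1: "cut f x 1 = length (f (x 0))"
  by (simp add: subsequence_def)

lemma prefix_conc_agree:
  "prefix n x = prefix n y \<Longrightarrow> prefix n (w \<frown> x) = prefix n (w \<frown> y)"
  by (rule prefix_mono_eq[where n = "length w + n"]) (simp_all only: prefix_conc_eq_iff)

lemma append_suffix_cancel: "xs @ us = ys @ vs \<Longrightarrow> length vs \<le> length us \<Longrightarrow> \<exists>B. us = B @ vs"
  by (auto simp: append_eq_append_conv2)

section \<open>Self-similarity of the branch point\<close>

locale quasi_invertible_substitution =
  fixes \<tau> :: "'a::finite \<Rightarrow> 'a list" and u :: "nat \<Rightarrow> 'a"
  assumes subst: "is_substitution \<tau>"
    and prim: "primitive_on UNIV \<tau>"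
    and infinite: "infinite (subst_space u)"
    and recog: "unilaterally_recognizable \<tau> u"
    and inj: "inj \<tau>"
    and fixed: "subst_seq \<tau> u = u"
    and qinv: "quasi_invertible (subst_space u)"
begin

abbreviation "X \<equiv> subst_space u"
abbreviation "T \<equiv> seq_img \<tau>"

lemma ne: "nonerasing \<tau>"
  using subst by (simp add: nonerasing_def is_substitution_def)

lemma T_u: "T u = u"
  using fixed by (simp add: seq_img_eq_subst_seq)

lemma X_iff: "x \<in> X \<longleftrightarrow> (\<forall>n. \<exists>m. prefix n (suffix m u) = prefix n x)"
  by (simp add: subst_space_def closure_of_seq_top funpow_shift)

lemma closed_X: "closedin seq_top X"
  by (simp add: subst_space_def)

lemma compact_X: "compactin seq_top X"
  by (rule compactin_seq_top[OF closed_X, of UNIV]) auto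

lemma X_approx: "x \<in> X \<Longrightarrow> \<exists>m. prefix n (suffix m u) = prefix n x"
  unfolding X_iff by blast

lemma orbit_in_X: "suffix m u \<in> X"
  unfolding X_iff by blast

lemma suffix_X: "x \<in> X \<Longrightarrow> suffix k x \<in> X"
  unfolding X_iff[of "suffix k x"]
proof
  fix n assume "x \<in> X"
  then obtain m where "prefix (k + n) (suffix m u) = prefix (k + n) x" using X_approx by blast
  from prefix_suffix_eq[OF this] show "\<exists>m. prefix n (suffix m u) = prefix n (suffix k x)"
    unfolding suffix_suffix by blast
qed

lemma T_suffix_u: "T (suffix n u) = suffix (cut \<tau> u n) u"
  using suffix_seq_img[OF ne, of u n] by (simp add: T_u)

lemma T_X: "x \<in> X \<Longrightarrow> T x \<in> X"
  unfolding X_iff[of "T x"]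
proof
  fix n assume "x \<in> X"
  then obtain m where "prefix n (suffix m u) = prefix n x" using X_approx by blast
  from prefix_seq_img_agree'[OF ne this] show "\<exists>m. prefix n (suffix m u) = prefix n (T x)"
    unfolding T_suffix_u by blast
qed

section \<open>Growth, uniform recurrence and aperiodicity\<close>

lemma word_pow_covers: "\<exists>p. \<forall>a b. b \<in> set (word_pow \<tau> p a)"
  using prim primitive_on_iff[of "UNIV :: 'a set" \<tau>] by auto

lemma word_pow_add: "word_pow \<tau> (m + n) a = word_img (word_pow \<tau> m) (word_pow \<tau> n a)"
  by (simp add: funpow_add word_img_pow[symmetric])

lemma two_letters: "2 \<le> card (UNIV :: 'a set)"
proof (rule ccontr)
  assume "\<not> 2 \<le> card (UNIV :: 'a set)"
  moreover have "card (UNIV :: 'a set) > 0" by (simp add: card_gt_0_iff)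
  ultimately have "card (UNIV :: 'a set) = 1" by linarith
  then obtain a :: 'a where "UNIV = {a}" by (auto simp: card_1_singleton_iff)
  then have "x = u" for x by (metis (full_types) UNIV_I ext singletonD)
  then have "X \<subseteq> {u}" by blast
  with infinite show False using finite_subset by blast
qed

text \<open>Some power of \<open>\<tau>\<close> maps each letter to a word containing the whole
  alphabet, hence of length at least 2, so it at least doubles lengths.\<close>

lemma word_pow_long: "\<exists>n. \<forall>a. N \<le> length (word_pow \<tau> n a)"
proof -
  obtain p where p: "\<And>a b. b \<in> set (word_pow \<tau> p a)" using word_pow_covers by blast
  have 2: "2 \<le> length (word_pow \<tau> p a)" for a
  proof -
    have "card (UNIV :: 'a set) \<le> card (set (word_pow \<tau> p a))" using p by (intro card_mono) auto
    then show ?thesis using two_letters card_length[of "word_pow \<tau> p a"] by linarith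
  qed
  have dbl: "2 * length w \<le> length (word_img (word_pow \<tau> p) w)" for w
  proof (induction w)
    case (Cons a w)
    then show ?case using 2[of a] by simp
  qed simp
  have "2 ^ k \<le> length (word_pow \<tau> (p * k) a)" for k a
  proof (induction k)
    case (Suc k)
    have "2 ^ Suc k \<le> 2 * length (word_pow \<tau> (p * k) a)" using Suc by simp
    also have "\<dots> \<le> length (word_pow \<tau> (p * Suc k) a)"
      using dbl unfolding mult_Suc_right word_pow_add by blast
    finally show ?case .
  qed simp
  then have "N \<le> length (word_pow \<tau> (p * N) a)" for a
    using less_exp[of N] by (meson less_imp_le order_trans)
  then show ?thesis by blast
qed

text \<open>\<open>u\<close> is a concatenation of blocks \<open>word_pow \<tau> (k + p) a\<close>,
  and each of them contains the word \<open>word_pow \<tau> k (u 0)\<close>, which begins with the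
  first \<open>n\<close> letters of \<open>u\<close>.\<close>

lemma u_uniformly_recurrent: "\<exists>G. \<forall>m. \<exists>t\<le>G. prefix n (suffix (m + t) u) = prefix n u"
proof -
  obtain p where p: "\<And>a b. b \<in> set (word_pow \<tau> p a)" using word_pow_covers by blast
  obtain k where k: "\<And>a. n \<le> length (word_pow \<tau> k a)" using word_pow_long[of n] by blast
  let ?f = "word_pow \<tau> (k + p)" and ?w = "word_pow \<tau> k (u 0)"
  have nef: "nonerasing ?f" and nek: "nonerasing (word_pow \<tau> k)" by (rule nonerasing_pow[OF ne])+
  have pow: "seq_img (word_pow \<tau> i) u = u" for i
    unfolding seq_img_pow[OF ne, symmetric] by (induction i) (simp_all add: T_u)
  define B where "B = Max (range (\<lambda>a. length (?f a)))"
  have B: "length (?f a) \<le> B" for a unfolding B_def by (rule Max_ge) auto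
  have occ: "\<exists>A A'. ?f a = A @ ?w @ A'" for a
  proof -
    obtain c c' where "word_pow \<tau> p a = c @ u 0 # c'" using p[of "u 0" a] by (meson split_list)
    then show ?thesis unfolding word_pow_add by auto
  qed
  have u0: "prefix n u = take n ?w"
    using k[of "u 0"] seq_img_split_first[OF nek, of u] unfolding pow by (metis prefix_conc_fst)
  have "\<exists>t\<le>2 * B. prefix n (suffix (m + t) u) = prefix n u" for m
  proof -
    obtain q i where qi: "i < length (?f (u q))" "m = cut ?f u q + i"
      using position_in_image[OF nef, of u m] by blast
    obtain A A' where A: "?f (u (Suc q)) = A @ ?w @ A'" using occ by blast
    \<comment> \<open>The occurrence is taken in the block after the one containing
      \<open>m\<close>, so that it begins beyond \<open>m\<close>; two block lengths bound the
      gap.\<close>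
    define t where "t = length (?f (u q)) - i + length A"
    have "m + t = cut ?f u (Suc q) + length A"
      using qi by (simp add: t_def subseq_to_Suc)
    then have "suffix (m + t) u = suffix (length A) (suffix (cut ?f u (Suc q)) (seq_img ?f u))"
      unfolding pow by simp
    also have "suffix (cut ?f u (Suc q)) (seq_img ?f u) = (A @ ?w @ A') \<frown> seq_img ?f (suffix 1 (suffix (Suc q) u))"
      unfolding suffix_seq_img[OF nef] by (subst seq_img_split_first[OF nef]) (simp add: A suffix_nth)
    finally have "suffix (m + t) u = ?w \<frown> A' \<frown> seq_img ?f (suffix 1 (suffix (Suc q) u))" by simp
    then have "prefix n (suffix (m + t) u) = take n ?w"
      using k[of "u 0"] by simp
    moreover have "t \<le> 2 * B" using B[of "u q"] B[of "u (Suc q)"] A by (simp add: t_def)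
    ultimately show ?thesis using u0 by auto
  qed
  then show ?thesis by blast
qed

lemma uniformly_recurrent:
  assumes "y \<in> X"
  shows "\<exists>G. \<forall>x\<in>X. \<exists>t\<le>G. prefix n (suffix t x) = prefix n y"
proof -
  obtain k where k: "prefix n (suffix k u) = prefix n y" using X_approx[OF assms] by blast
  obtain G where G: "\<And>m. \<exists>t\<le>G. prefix (k + n) (suffix (m + t) u) = prefix (k + n) u"
    using u_uniformly_recurrent[of "k + n"] by blast
  \<comment> \<open>The word sought sits \<open>k\<close> places after a recurring prefix of
    \<open>u\<close>, which adds \<open>k\<close> to the gap.\<close>
  have "\<exists>t\<le>G + k. prefix n (suffix t x) = prefix n y" if "x \<in> X" for x
  proof -
    obtain m where m: "prefix (G + k + n) (suffix m u) = prefix (G + k + n) x"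
      using X_approx[OF \<open>x \<in> X\<close>] by blast
    obtain t where t: "t \<le> G" "prefix (k + n) (suffix (m + t) u) = prefix (k + n) u" using G by blast
    have "prefix n (suffix k (suffix (m + t) u)) = prefix n (suffix k u)" by (rule prefix_suffix_eq[OF t(2)])
    moreover have "prefix n (suffix (t + k) (suffix m u)) = prefix n (suffix (t + k) x)"
      by (rule prefix_suffix_eq, rule prefix_mono_eq[OF m]) (use t(1) in simp)
    ultimately have "prefix n (suffix (t + k) x) = prefix n y"
      using k by (simp add: add.assoc)
    then show ?thesis using t(1) by (intro exI[of _ "t + k"]) simp
  qed
  then show ?thesis by blast
qed

text \<open>By recurrence a word of \<open>u\<close> also occurs at a positive position, so the
  shifted copy of \<open>X\<close> is dense in \<open>X\<close>, and it is compact.\<close>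

lemma suffix_surj: "x \<in> X \<Longrightarrow> \<exists>y\<in>X. suffix k y = x"
proof (induction k arbitrary: x)
  case (Suc k)
  have "closedin seq_top (suffix 1 ` X)"
    by (rule compactin_seq_top_closedin[OF image_compactin[OF compact_X continuous_map_suffix]])
  moreover have "\<exists>y\<in>suffix 1 ` X. prefix n y = prefix n x" for n
  proof -
    obtain m where m: "prefix n (suffix m u) = prefix n x" using X_approx[OF Suc.prems] by blast
    obtain G where G: "\<forall>y\<in>X. \<exists>t\<le>G. prefix n (suffix t y) = prefix n (suffix m u)"
      using uniformly_recurrent[OF orbit_in_X] by blast
    then obtain t where "prefix n (suffix t (suffix 1 u)) = prefix n (suffix m u)"
      using orbit_in_X by blast
    then have "prefix n (suffix 1 (suffix t u)) = prefix n x" using m by simp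
    then show ?thesis using orbit_in_X by blast
  qed
  ultimately have "x \<in> suffix 1 ` X" by (rule closedin_seq_topD)
  then obtain x1 where "x1 \<in> X" "suffix 1 x1 = x" by blast
  moreover from Suc.IH[OF this(1)] obtain y where "y \<in> X" "suffix k y = x1" by blast
  ultimately show ?case by (metis Suc_eq_plus1 suffix_suffix)
qed auto

text \<open>Every orbit is dense by uniform recurrence, while the orbit of a periodic point is
  finite and hence closed; this contradicts the infinitude of \<open>X\<close>.\<close>

lemma aperiodic:
  assumes "x \<in> X" "k > 0"
  shows "suffix k x \<noteq> x"
proof
  assume per: "suffix k x = x"
  have mult: "suffix (j * k) x = x" for j
  proof (induction j)
    case (Suc j)
    have "suffix (Suc j * k) x = suffix (j * k) (suffix k x)" by simp
    then show ?case using Suc per by simp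
  qed simp
  have mod: "suffix t x = suffix (t mod k) x" for t
  proof -
    have "suffix t x = suffix (t mod k) (suffix (t div k * k) x)" by simp
    then show ?thesis unfolding mult .
  qed
  let ?F = "(\<lambda>r. suffix r x) ` {..<k}"
  have F: "suffix t x \<in> ?F" for t using assms(2) by (subst mod) auto
  have "closedin seq_top ?F"
    by (intro compactin_seq_top_closedin finite_imp_compactin) auto
  moreover have "\<exists>z\<in>?F. prefix n z = prefix n y" if y: "y \<in> X" for y n
    using uniformly_recurrent[OF y, of n] assms(1) F by blast
  ultimately have "X \<subseteq> ?F" using closedin_seq_topD by blast
  with infinite show False using finite_subset by blast
qed

section \<open>Recognizability on the whole subshift\<close>

lemma cut_set_eq: "cut_set \<tau> u = range (cut \<tau> u)"
proof -
  have "cut_set \<tau> u = {cut \<tau> u 0} \<union> cut \<tau> u ` {p. p > 0}"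
    unfolding cut_set_def subst_word_def subsequence_def by auto
  also have "\<dots> = cut \<tau> u ` ({0} \<union> {p. p > 0})" by (simp only: image_Un image_insert image_empty)
  also have "{0} \<union> {p :: nat. p > 0} = UNIV" by auto
  finally show ?thesis .
qed

text \<open>\<open>z\<close> and \<open>z'\<close> are replaced by shifts of \<open>u\<close>
  agreeing with them on \<open>j + L\<close> letters. This shows \<open>L\<close> letters beyond
  position \<open>j\<close> of the image, and it is enough to transfer the boundary found at
  \<open>j\<close> back to \<open>z\<close>.\<close>

lemma recognizable_cut:
  assumes "z \<in> X" "z' \<in> X" "suffix j (T z) = T z'"
  shows "\<exists>q. j = cut \<tau> z q"
proof -
  obtain L where "\<forall>i j. i \<in> cut_set \<tau> u \<and> map u [i..<i+L] = map u [j..<j+L] \<longrightarrow> j \<in> cut_set \<tau> u"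
    using recog unfolding unilaterally_recognizable_def by blast
  then have L0: "j \<in> range (cut \<tau> u)" if "i \<in> range (cut \<tau> u)" "prefix L (suffix i u) = prefix L (suffix j u)" for i j
    using that unfolding cut_set_eq subsequence_shift by (simp add: subsequence_def)
  have L: "\<exists>q. j = cut \<tau> u q" if "prefix L (suffix (cut \<tau> u p) u) = prefix L (suffix j u)" for p j
    using L0[OF rangeI that] by blast
  obtain n where n: "prefix (j + L) (suffix n u) = prefix (j + L) z" using X_approx[OF assms(1)] by blast
  obtain n' where n': "prefix (j + L) (suffix n' u) = prefix (j + L) z'" using X_approx[OF assms(2)] by blast
  have "prefix (j + L) (suffix (cut \<tau> u n) u) = prefix (j + L) (T z)"
    using prefix_seq_img_agree'[OF ne n] by (simp only: T_suffix_u)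
  from prefix_suffix_eq[OF this] have "prefix L (suffix (cut \<tau> u n + j) u) = prefix L (T z')"
    using assms(3) by simp
  moreover have "prefix L (suffix (cut \<tau> u n') u) = prefix L (T z')"
    using prefix_mono_eq[OF prefix_seq_img_agree'[OF ne n']] by (simp only: T_suffix_u)
  ultimately obtain m where m: "cut \<tau> u n + j = cut \<tau> u m" using L by metis
  have "n \<le> m"
    using m length_word_img_prefix_strict_mono[OF ne, of m n u] by (metis le_add1 leD not_less)
  then obtain d where d: "m = n + d" using le_Suc_ex by blast
  then have j: "j = cut \<tau> (suffix n u) d" using m by (simp add: cut_add)
  then have "d \<le> j + L" using cut_ge[OF ne, of d "suffix n u"] by simp
  from prefix_mono_eq[OF n this] have "j = cut \<tau> z d" using j by simp
  then show ?thesis by blast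
qed

text \<open>The end of the first block of \<open>z\<close> is a block boundary of \<open>z'\<close>
  as well, so the first block of \<open>z'\<close> cannot reach beyond it.\<close>

lemma first_image_le:
  assumes "z \<in> X" "z' \<in> X" "T z = T z'"
  shows "length (\<tau> (z' 0)) \<le> length (\<tau> (z 0))"
proof -
  have "suffix (cut \<tau> z 1) (T z') = T (suffix 1 z)"
    unfolding assms(3)[symmetric] by (rule suffix_seq_img[OF ne])
  from recognizable_cut[OF assms(2) suffix_X[OF assms(1)] this]
  obtain q where q: "cut \<tau> z 1 = cut \<tau> z' q" by blast
  have "q \<noteq> 0" using q nonerasing_length[OF ne, of "z 0"] by (auto simp: cut_1)
  then have "cut \<tau> z' 1 \<le> cut \<tau> z' q" by (intro length_word_img_prefix_mono) simp
  then show ?thesis using q by (simp only: cut_1)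
qed

text \<open>Equal lengths of the first blocks make these blocks equal, so the first letters agree;
  removing them restores the hypothesis.\<close>

lemma T_inj:
  assumes "z \<in> X" "z' \<in> X" "T z = T z'"
  shows "z = z'"
proof
  have first: "z 0 = z' 0" if "z \<in> X" "z' \<in> X" "T z = T z'" for z z'
  proof -
    have l: "cut \<tau> z 1 = cut \<tau> z' 1"
      using first_image_le[OF that] first_image_le[OF that(2,1) that(3)[symmetric]] by (simp only: cut_1)
    have "word_img \<tau> (prefix 1 z) = word_img \<tau> (prefix 1 z')"
      using prefix_seq_img[OF ne, of z 1] prefix_seq_img[OF ne, of z' 1] that(3) l by metis
    then show ?thesis using injD[OF inj] by (simp add: subsequence_def)
  qed
  have step: "T (suffix n z) = T (suffix n z')" for n
  proof (induction n)
    case (Suc n)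
    have "suffix n z 0 = suffix n z' 0" using first[OF suffix_X suffix_X Suc] assms by blast
    then have "cut \<tau> (suffix n z) 1 = cut \<tau> (suffix n z') 1" by (simp only: cut_1)
    then have "T (suffix 1 (suffix n z)) = T (suffix 1 (suffix n z'))"
      using suffix_seq_img[OF ne, of "suffix n z" 1] suffix_seq_img[OF ne, of "suffix n z'" 1] Suc
      by (simp only:)
    then show ?case by simp
  qed (simp add: assms(3))
  fix n
  show "z n = z' n" using first[OF suffix_X suffix_X step[of n]] assms by (simp add: suffix_nth)
qed

lemma recognizable:
  assumes "z \<in> X" "z' \<in> X" "suffix j (T z) = T z'"
  shows "\<exists>q. j = cut \<tau> z q \<and> suffix q z = z'"
proof -
  obtain q where q: "j = cut \<tau> z q" using recognizable_cut[OF assms] by blast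
  then have "T (suffix q z) = T z'" using assms(3) suffix_seq_img[OF ne, of z q] by simp
  then show ?thesis using T_inj[OF suffix_X[OF assms(1)] assms(2)] q by blast
qed

section \<open>The branch point and unique backtracking\<close>

definition b where "b = (THE x. branch_point X x)"

lemma b_branch: "branch_point X b"
  unfolding b_def using qinv[unfolded quasi_invertible_def] by (rule theI')

lemma branch_point_eq_b: "branch_point X x \<Longrightarrow> x = b"
  using qinv b_branch unfolding quasi_invertible_def by blast

lemma b_in_X: "b \<in> X"
  using b_branch by (simp add: branch_point_def)

lemma backtrack_one:
  assumes "y \<in> X" "y' \<in> X" "suffix 1 y = suffix 1 y'" "suffix 1 y \<noteq> b"
  shows "y = y'"
proof (rule ccontr)
  assume "y \<noteq> y'"
  then have "branch_point X (suffix 1 y)"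
    unfolding branch_point_def shift_eq_suffix using assms(1-3) suffix_X by metis
  then show False using assms(4) branch_point_eq_b by blast
qed

text \<open>The index \<open>k = 0\<close> is excluded: arriving at \<open>b\<close> on the way back
  is harmless, only going back from \<open>b\<close> is ambiguous.\<close>

lemma backtrack:
  assumes "y \<in> X" "y' \<in> X" "suffix m y = suffix m y'" "\<And>k. 0 < k \<Longrightarrow> k \<le> m \<Longrightarrow> suffix k y \<noteq> b"
  shows "y = y'"
  using assms(3,4)
proof (induction m)
  case (Suc m)
  have "suffix 1 (suffix m y) = suffix 1 (suffix m y')" "suffix 1 (suffix m y) \<noteq> b"
    using Suc.prems(1) Suc.prems(2)[of "Suc m"] by simp_all
  then have "suffix m y = suffix m y'" by (rule backtrack_one[OF suffix_X[OF assms(1)] suffix_X[OF assms(2)]])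
  then show ?case using Suc.IH Suc.prems(2) by simp
qed simp

lemma T_b_in_orbit: "\<exists>l. T b = suffix l b"
proof -
  obtain y1 y2 where y: "y1 \<in> X" "y2 \<in> X" "y1 \<noteq> y2" "suffix 1 y1 = b" "suffix 1 y2 = b"
    using b_branch unfolding branch_point_def shift_eq_suffix by blast
  \<comment> \<open>The two images are compared exactly \<open>m\<close> letters before
    \<open>T b\<close>. The block of \<open>y2 0\<close> may be shorter than \<open>m\<close>, so
    \<open>y2\<close> is first extended into the past.\<close>
  define m where "m = cut \<tau> y1 1"
  have m: "m > 0" using nonerasing_length[OF ne, of "y1 0"] by (simp only: m_def cut_1)
  obtain y' where y': "y' \<in> X" "suffix (m - 1) y' = y2" using suffix_surj[OF y(2)] by blast
  have y'b: "suffix m y' = b" using y(5) m unfolding y'(2)[symmetric] by simp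
  define t where "t = cut \<tau> y' m - m"
  have tm: "t + m = cut \<tau> y' m" using cut_ge[OF ne, of m y'] by (simp add: t_def)
  define p p' where "p = T y1" and "p' = suffix t (T y')"
  have pX: "p \<in> X" "p' \<in> X" using y(1) y'(1) by (auto simp: p_def p'_def intro: T_X suffix_X)
  have pb: "suffix m p = T b" using suffix_seq_img[OF ne, of y1 1] y(4) by (simp only: p_def m_def)
  have p'b: "suffix m p' = T b"
    using suffix_seq_img[OF ne, of y' m] y'b by (simp only: p'_def suffix_suffix tm)
  have "p \<noteq> p'"
  proof
    assume "p = p'"
    \<comment> \<open>Recognizability would place \<open>y1\<close> at position \<open>q\<close> of
      \<open>y'\<close>, so \<open>b\<close> would occur in \<open>y'\<close> at
      \<open>q + 1\<close> and at \<open>m\<close>. Aperiodicity identifies these positions, and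
      then \<open>y1 = y2\<close>.\<close>
    then have "suffix t (T y') = T y1" by (simp only: p_def p'_def)
    from recognizable[OF y'(1) y(1) this] obtain q where q: "t = cut \<tau> y' q" "suffix q y' = y1" by blast
    have "cut \<tau> y' q < cut \<tau> y' m" using q(1) tm m by linarith
    then have "q < m" by (rule cut_less_cancel)
    then have "suffix (m - q - 1) b = suffix m y'" unfolding y(4)[symmetric] q(2)[symmetric] by simp
    then have "m - q - 1 = 0" using aperiodic[OF b_in_X, of "m - q - 1"] y'b by (metis not_gr_zero)
    with \<open>q < m\<close> have "q = m - 1" by simp
    then show False using q(2) y'(2) y(3) by simp
  qed
  \<comment> \<open>At the first merging time the points have distinct predecessors, so they meet in
    \<open>b\<close>; the remaining \<open>m - j\<close> steps lead from \<open>b\<close> to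
    \<open>T b\<close>.\<close>
  define j where "j = (LEAST j. suffix j p = suffix j p')"
  have ex: "suffix m p = suffix m p'" using pb p'b by simp
  have j: "suffix j p = suffix j p'" "j \<le> m"
    unfolding j_def using LeastI[of "\<lambda>j. suffix j p = suffix j p'", OF ex]
      Least_le[of "\<lambda>j. suffix j p = suffix j p'", OF ex] by blast+
  have "j \<noteq> 0" using j(1) \<open>p \<noteq> p'\<close> by auto
  then obtain i where i: "j = Suc i" using not0_implies_Suc by blast
  have ni: "suffix i p \<noteq> suffix i p'"
    using not_less_Least[of i "\<lambda>j. suffix j p = suffix j p'"] i by (auto simp: j_def)
  have "suffix 1 (suffix i p) = suffix 1 (suffix i p')" using j(1) i by simp
  then have "suffix 1 (suffix i p) = b"
    using ni backtrack_one[OF suffix_X[OF pX(1)] suffix_X[OF pX(2)]] by blast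
  then have "suffix j p = b" using i by simp
  then have "suffix (m - j) b = suffix m p" using j(2) by (metis le_add_diff_inverse suffix_suffix)
  then show ?thesis using pb by metis
qed

definition l where "l = (SOME l. T b = suffix l b)"
definition s where "s = prefix l b"

lemma T_b: "T b = suffix l b"
  unfolding l_def using T_b_in_orbit by (rule someI_ex)

lemma length_s: "length s = l"
  by (simp add: s_def)

lemma s_T_b: "s \<frown> T b = b"
  unfolding T_b s_def by (rule prefix_suffix[symmetric])

text \<open>The last \<open>l\<close> letters of the image of \<open>v\<close>, followed by
  \<open>T b\<close>, form a point whose \<open>l\<close>-fold shift is \<open>suffix l b\<close>.
  No positive shift of \<open>b\<close> is \<open>b\<close>, so backtracking is unique and this
  point is \<open>b\<close>.\<close>

lemma image_past_of_b:
  assumes "v \<frown> b \<in> X" "length v = l"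
  shows "\<exists>A. word_img \<tau> v = A @ s"
proof -
  let ?W = "word_img \<tau> v"
  define y where "y = suffix (length ?W - l) (T (v \<frown> b))"
  have "l \<le> length ?W" using length_word_img_ge[OF ne, of v] assms(2) by simp
  then have y: "y = drop (length ?W - l) ?W \<frown> T b" and len: "length (drop (length ?W - l) ?W) = l"
    by (simp_all add: y_def seq_img_conc[OF ne])
  have "suffix l y = suffix l b" unfolding y T_b[symmetric] using len by (metis suffix_conc_length)
  moreover have "y \<in> X" unfolding y_def by (intro suffix_X T_X assms(1))
  ultimately have "b = y"
    using aperiodic[OF b_in_X] by (intro backtrack[OF b_in_X _ , of y l]) auto
  then have "s = drop (length ?W - l) ?W" unfolding s_def using y len by (metis prefix_conc_length)
  then have "?W = take (length ?W - l) ?W @ s" by simp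
  then show ?thesis by blast
qed

text \<open>There are finitely many words \<open>v\<close> of length \<open>l\<close>. Either
  \<open>v \<frown> b\<close> lies in \<open>X\<close>, or, \<open>X\<close> being closed, no point
  of \<open>X\<close> continues \<open>v\<close> by a long prefix of \<open>b\<close>; in the second
  case the claim is vacuous for large \<open>M\<close>.\<close>

lemma image_past_near_b:
  "\<exists>M. \<forall>y\<in>X. prefix M (suffix l y) = prefix M b \<longrightarrow> (\<exists>A. word_img \<tau> (prefix l y) = A @ s)"
proof -
  define Q where "Q v M \<longleftrightarrow> (\<forall>y\<in>X. prefix l y = v \<longrightarrow> prefix M (suffix l y) = prefix M b \<longrightarrow>
    (\<exists>A. word_img \<tau> v = A @ s))" for v M
  have "eventually (Q v) sequentially" if v: "length v = l" for v
  proof (cases "v \<frown> b \<in> X")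
    case True
    have "\<exists>A. word_img \<tau> v = A @ s" by (rule image_past_of_b[OF True v])
    then have "Q v M" for M unfolding Q_def by blast
    then show ?thesis by (rule always_eventually[OF allI])
  next
    case False
    then obtain M where M: "\<And>y. y \<in> X \<Longrightarrow> prefix M y \<noteq> prefix M (v \<frown> b)"
      using closedin_seq_topD[OF closed_X] by blast
    have "Q v m" if "M \<le> m" for m
      unfolding Q_def
    proof (intro ballI impI)
      fix y assume y: "y \<in> X" "prefix l y = v" "prefix m (suffix l y) = prefix m b"
      have "y = v \<frown> suffix l y" using prefix_suffix[of y l] y(2) by simp
      then have "prefix m y = prefix m (v \<frown> b)" using prefix_conc_agree[OF y(3), of v] by simp
      then have "prefix M y = prefix M (v \<frown> b)" using \<open>M \<le> m\<close> by (rule prefix_mono_eq)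
      then show "\<exists>A. word_img \<tau> v = A @ s" using M[OF y(1)] by blast
    qed
    then show ?thesis by (auto simp: eventually_sequentially)
  qed
  then have "eventually (\<lambda>M. \<forall>v\<in>{v. length v = l}. Q v M) sequentially"
    using finite_lists_length_eq[of "UNIV :: 'a set" l] by (intro eventually_ball_finite) auto
  then obtain M where "\<And>v. length v = l \<Longrightarrow> Q v M" by (auto simp: eventually_sequentially)
  then show ?thesis unfolding Q_def by (metis diff_zero subsequence_length)
qed

section \<open>Return words to the branch point\<close>

text \<open>By the choice of \<open>M\<close>, every point of the cylinder \<open>C\<close> around \<open>b\<close> has only pasts whose
  image ends in \<open>s\<close>; this is what makes \<open>s \<tau>(x)\<close> a point of \<open>X\<close> for \<open>x \<in> C\<close>.\<close>

definition M where
  "M = (SOME M. 0 < M \<and> (\<forall>y\<in>X. prefix M (suffix l y) = prefix M b \<longrightarrow> (\<exists>A. word_img \<tau> (prefix l y) = A @ s)))"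

definition C where "C = {x \<in> X. prefix M x = prefix M b}"

text \<open>Positivity of \<open>M\<close> makes all points of \<open>C\<close> share their first
  letter, from which the contraction in \<open>\<Psi>_pow_agree\<close> starts.\<close>

lemma M: "0 < M" "y \<in> X \<Longrightarrow> prefix M (suffix l y) = prefix M b \<Longrightarrow> \<exists>A. word_img \<tau> (prefix l y) = A @ s"
proof -
  obtain m where m: "\<And>y. y \<in> X \<Longrightarrow> prefix m (suffix l y) = prefix m b \<Longrightarrow> \<exists>A. word_img \<tau> (prefix l y) = A @ s"
    using image_past_near_b by blast
  have "0 < Suc m \<and> (\<forall>y\<in>X. prefix (Suc m) (suffix l y) = prefix (Suc m) b \<longrightarrow>
      (\<exists>A. word_img \<tau> (prefix l y) = A @ s))"
    using m prefix_mono_eq[where n = "Suc m" and m = m] by (metis le_SucI order_refl zero_less_Suc)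
  from someI[where P = "\<lambda>M. 0 < M \<and> (\<forall>y\<in>X. prefix M (suffix l y) = prefix M b \<longrightarrow>
      (\<exists>A. word_img \<tau> (prefix l y) = A @ s))", OF this, folded M_def]
  show "0 < M" "y \<in> X \<Longrightarrow> prefix M (suffix l y) = prefix M b \<Longrightarrow> \<exists>A. word_img \<tau> (prefix l y) = A @ s"
    by blast+
qed

lemma C_in_X: "x \<in> C \<Longrightarrow> x \<in> X"
  by (simp add: C_def)

lemma C_prefix: "x \<in> C \<Longrightarrow> prefix M x = prefix M b"
  by (simp add: C_def)

lemma C_I: "x \<in> X \<Longrightarrow> prefix M x = prefix M b \<Longrightarrow> x \<in> C"
  by (simp add: C_def)

lemma b_in_C: "b \<in> C"
  by (simp add: C_I b_in_X)

lemma C_agree: "x \<in> C \<Longrightarrow> y \<in> X \<Longrightarrow> prefix M y = prefix M x \<Longrightarrow> y \<in> C"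
  by (simp add: C_def)

lemma closed_C: "closedin seq_top C"
  unfolding closedin_seq_top_iff
proof (intro allI impI)
  fix x assume x: "\<forall>n. \<exists>y\<in>C. prefix n y = prefix n x"
  then have "x \<in> X" using C_in_X by (intro closedin_seq_topD[OF closed_X]) blast
  moreover obtain y where "y \<in> C" "prefix M y = prefix M x" using x by blast
  ultimately show "x \<in> C" using C_agree[of y x] by simp
qed

section \<open>The contraction towards the branch point\<close>

definition \<Psi> where "\<Psi> x = s \<frown> T x"

lemma suffix_\<Psi>: "suffix l (\<Psi> x) = T x"
  unfolding \<Psi>_def length_s[symmetric] by simp

lemma \<Psi>_b: "\<Psi> b = b"
  by (simp only: \<Psi>_def s_T_b)

text \<open>For a past \<open>y\<close> of \<open>x\<close>, the point \<open>\<Psi> x\<close> is a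
  shift of \<open>T y\<close>, which puts it into \<open>X\<close>. It stays in the cylinder because
  \<open>\<Psi>\<close> does not shorten common prefixes and fixes \<open>b\<close>.\<close>

lemma \<Psi>_C:
  assumes "x \<in> C"
  shows "\<Psi> x \<in> C"
proof (rule C_I)
  obtain y where y: "y \<in> X" "suffix l y = x" using suffix_surj[OF C_in_X[OF assms]] by blast
  obtain A where A: "word_img \<tau> (prefix l y) = A @ s" using M(2)[OF y(1)] C_prefix[OF assms] y(2) by blast
  have "T y = A \<frown> \<Psi> x" using seq_img_split[OF ne, of y l] by (simp add: y(2) A \<Psi>_def)
  then have "\<Psi> x = suffix (length A) (T y)" by simp
  then show "\<Psi> x \<in> X" using suffix_X[OF T_X[OF y(1)]] by simp
  show "prefix M (\<Psi> x) = prefix M b"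
    using prefix_conc_agree[OF prefix_seq_img_agree'[OF ne C_prefix[OF assms]], of s] by (simp only: \<Psi>_def s_T_b)
qed

text \<open>Extend \<open>x\<close> by a past of length \<open>l\<close>. The image of that past
  ends in \<open>s\<close> because \<open>x\<close> is in \<open>C\<close>; the image of the past
  followed by \<open>prefix p x\<close> also ends in \<open>s\<close> because
  \<open>suffix p x\<close> is in \<open>C\<close>. Comparing the two ends carries \<open>s\<close>
  across.\<close>

lemma s_conjugates:
  assumes "x \<in> C" "suffix p x \<in> C"
  shows "\<exists>B. s @ word_img \<tau> (prefix p x) = B @ s"
proof -
  obtain y where y: "y \<in> X" "suffix l y = x" using suffix_surj[OF C_in_X[OF assms(1)]] by blast
  obtain A where A: "word_img \<tau> (prefix l y) = A @ s" using M(2)[OF y(1)] C_prefix[OF assms(1)] y(2) by blast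
  have "suffix l (suffix p y) = suffix p x" by (simp add: y(2)[symmetric] add.commute)
  then obtain A' where A': "word_img \<tau> (prefix l (suffix p y)) = A' @ s"
    using M(2)[OF suffix_X[OF y(1)], of p] C_prefix[OF assms(2)] by auto
  have "prefix l y @ prefix p x = prefix p y @ prefix l (suffix p y)"
    using prefix_add[of y l p] prefix_add[of y p l] by (simp add: y(2) add.commute)
  from arg_cong[OF this, of "word_img \<tau>"]
  have "A @ (s @ word_img \<tau> (prefix p x)) = (word_img \<tau> (prefix p y) @ A') @ s" by (simp add: A A')
  then show ?thesis by (rule append_suffix_cancel) simp
qed

lemma suffix_cut_\<Psi>:
  assumes "x \<in> C" "suffix p x \<in> C"
  shows "suffix (cut \<tau> x p) (\<Psi> x) = \<Psi> (suffix p x)"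
proof -
  obtain B where B: "s @ word_img \<tau> (prefix p x) = B @ s" using s_conjugates[OF assms] by blast
  then have len: "length B = cut \<tau> x p" by (metis B add.commute add_right_cancel length_append)
  have "\<Psi> x = (s @ word_img \<tau> (prefix p x)) \<frown> T (suffix p x)"
    by (simp only: \<Psi>_def conc_conc[symmetric] seq_img_split[OF ne, of x p, symmetric])
  also have "\<dots> = B \<frown> \<Psi> (suffix p x)" unfolding B by (simp add: \<Psi>_def)
  finally show ?thesis unfolding len[symmetric] by simp
qed

text \<open>After dropping \<open>s\<close> from both sides this is recognizability: a return of the
  image comes from a shift of \<open>x\<close> itself.\<close>

lemma \<Psi>_return:
  assumes "x \<in> C" "x' \<in> C" "suffix j (\<Psi> x) = \<Psi> x'"
  shows "\<exists>q. j = cut \<tau> x q \<and> suffix q x = x'"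
proof (rule recognizable[OF C_in_X[OF assms(1)] C_in_X[OF assms(2)]])
  have "suffix j (suffix l (\<Psi> x)) = suffix l (suffix j (\<Psi> x))" by (simp add: add.commute)
  then show "suffix j (T x) = T x'" unfolding assms(3) suffix_\<Psi> .
qed

lemma \<Psi>_pow_b: "(\<Psi> ^^ n) b = b"
  by (induction n) (auto simp: \<Psi>_b)

text \<open>The \<open>n\<close>-th iterate is a word \<open>S\<close> independent of
  \<open>x\<close> followed by the \<open>n\<close>-fold image of \<open>x\<close>. Points of
  \<open>C\<close> share their first letter, and its \<open>n\<close>-fold image is already long
  enough.\<close>

lemma \<Psi>_pow_agree: "\<exists>n. \<forall>x\<in>C. prefix N ((\<Psi> ^^ n) x) = prefix N b"
proof -
  obtain n where n: "\<And>a. N \<le> length (word_pow \<tau> n a)" using word_pow_long[of N] by blast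
  have "\<exists>S. \<forall>x. (\<Psi> ^^ m) x = S \<frown> (T ^^ m) x" for m
  proof (induction m)
    case (Suc m)
    then obtain S where "\<And>x. (\<Psi> ^^ m) x = S \<frown> (T ^^ m) x" by blast
    then have "(\<Psi> ^^ Suc m) x = (s @ word_img \<tau> S) \<frown> (T ^^ Suc m) x" for x
      by (simp add: \<Psi>_def seq_img_conc[OF ne])
    then show ?case by blast
  qed (auto intro: exI[of _ "[]"])
  then obtain S where S: "\<And>x. (\<Psi> ^^ n) x = S \<frown> seq_img (word_pow \<tau> n) x"
    unfolding seq_img_pow[OF ne] by blast
  have "prefix N ((\<Psi> ^^ n) x) = prefix N b" if "x \<in> C" for x
  proof -
    have "prefix 1 x = prefix 1 b"
      using M(1) by (intro prefix_mono_eq[OF C_prefix[OF that]]) simp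
    from prefix_seq_img_agree[OF nonerasing_pow[OF ne] this, of n]
    have "prefix N (seq_img (word_pow \<tau> n) x) = prefix N (seq_img (word_pow \<tau> n) b)"
      by (rule prefix_mono_eq) (simp only: cut_1 n)
    from prefix_conc_agree[OF this, of S] show ?thesis
      unfolding S[symmetric] \<Psi>_pow_b .
  qed
  then show ?thesis by blast
qed

section \<open>Return times and return words\<close>

definition ret where "ret x = (LEAST k. 0 < k \<and> suffix k x \<in> C)"

lemma C_gaps: "\<exists>G. \<forall>x\<in>X. \<exists>t\<le>G. suffix t x \<in> C"
  using uniformly_recurrent[OF b_in_X, of M] C_I suffix_X by meson

lemma ret_ex: "\<exists>G. \<forall>x\<in>X. \<exists>k\<le>G. 0 < k \<and> suffix k x \<in> C"
proof -
  obtain G where G: "\<And>x. x \<in> X \<Longrightarrow> \<exists>t\<le>G. suffix t x \<in> C" using C_gaps by blast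
  have "\<exists>k\<le>Suc G. 0 < k \<and> suffix k x \<in> C" if "x \<in> X" for x
  proof -
    have "suffix 1 x \<in> X" using that by (rule suffix_X)
    then obtain t where "t \<le> G" "suffix t (suffix 1 x) \<in> C" using G by blast
    then show ?thesis by (intro exI[of _ "Suc t"]) simp
  qed
  then show ?thesis by blast
qed

lemma ret:
  assumes "x \<in> X"
  shows "0 < ret x" "suffix (ret x) x \<in> C"
proof -
  have "\<exists>k. 0 < k \<and> suffix k x \<in> C" using ret_ex assms by blast
  from LeastI_ex[OF this] show "0 < ret x" "suffix (ret x) x \<in> C" by (simp_all add: ret_def)
qed

lemma ret_le: "0 < k \<Longrightarrow> suffix k x \<in> C \<Longrightarrow> ret x \<le> k"
  unfolding ret_def by (rule Least_le) simp

definition rw where "rw x = prefix (ret x) x"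

lemma length_rw: "length (rw x) = ret x"
  by (simp add: rw_def)

lemma finite_return_words: "finite (rw ` C)"
proof -
  obtain G where G: "\<And>x. x \<in> X \<Longrightarrow> \<exists>k\<le>G. 0 < k \<and> suffix k x \<in> C" using ret_ex by blast
  have "ret x \<le> G" if "x \<in> C" for x
    using G[OF C_in_X[OF that]] ret_le by (meson order_trans)
  then have "rw ` C \<subseteq> {w. set w \<subseteq> UNIV \<and> length w \<le> G}"
    by (intro image_subsetI) (simp add: length_rw)
  then show ?thesis by (rule finite_subset) (rule finite_lists_length_le, simp)
qed

text \<open>Whether a point returns to \<open>C\<close> at a time at most \<open>ret x\<close> is decided by its first \<open>ret x + M\<close> letters.\<close>

lemma rw_eqI:
  assumes x: "x \<in> C" and y: "y \<in> X" "y = rw x \<frown> y'" and y': "prefix M y' = prefix M b"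
  shows "y \<in> C" "ret y = ret x" "rw y = rw x"
proof -
  let ?x' = "suffix (ret x) x"
  have "prefix M y' = prefix M ?x'" using y' C_prefix[OF ret(2)[OF C_in_X[OF x]]] by simp
  moreover have "x = rw x \<frown> ?x'" unfolding rw_def by (rule prefix_suffix)
  ultimately have agree: "prefix (ret x + M) y = prefix (ret x + M) x"
    using prefix_conc_eq_iff[of "rw x" y' M ?x'] y(2) by (simp add: length_rw)
  have iff: "suffix k y \<in> C \<longleftrightarrow> suffix k x \<in> C" if "k \<le> ret x" for k
  proof -
    have "prefix (k + M) y = prefix (k + M) x" using that by (intro prefix_mono_eq[OF agree]) simp
    from prefix_suffix_eq[OF this] show ?thesis
      using suffix_X[OF C_in_X[OF x], of k] suffix_X[OF y(1), of k] by (simp add: C_def)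
  qed
  show "y \<in> C" using iff[of 0] x by simp
  show r: "ret y = ret x"
  proof (rule antisym)
    have "suffix (ret x) y \<in> C" using iff[of "ret x"] ret(2)[OF C_in_X[OF x]] by blast
    then show le: "ret y \<le> ret x" by (rule ret_le[OF ret(1)[OF C_in_X[OF x]]])
    show "ret x \<le> ret y" using iff[OF le] ret[OF y(1)] by (intro ret_le) auto
  qed
  show "rw y = rw x" unfolding rw_def[of y] r using y(2) by (simp add: length_rw[symmetric])
qed

section \<open>Coding by return words\<close>

definition V where "V = {0..<card (rw ` C)}"
definition enum where "enum = (SOME h. bij_betw h V (rw ` C))"
text \<open>The dummy word outside \<open>V\<close> keeps \<open>\<kappa>\<close> nonerasing on all
  naturals.\<close>

definition \<kappa> where "\<kappa> v = (if v \<in> V then enum v else [undefined])"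

lemma finite_V: "finite V"
  by (simp add: V_def)

lemma bij_\<kappa>: "bij_betw \<kappa> V (rw ` C)"
proof -
  have "\<exists>h. bij_betw h V (rw ` C)"
    unfolding V_def by (rule ex_bij_betw_nat_finite[OF finite_return_words])
  then have "bij_betw enum V (rw ` C)" unfolding enum_def by (rule someI_ex)
  then show ?thesis by (subst bij_betw_cong[of V \<kappa> enum]) (simp_all add: \<kappa>_def)
qed

lemma \<kappa>_obtain:
  assumes "v \<in> V" obtains x where "x \<in> C" "\<kappa> v = rw x"
  using assms bij_\<kappa> by (metis bij_betwE imageE)

lemma rw_obtain:
  assumes "x \<in> C" obtains v where "v \<in> V" "\<kappa> v = rw x"
  using assms bij_\<kappa> by (metis bij_betw_imp_surj_on imageE imageI)

lemma \<kappa>_inj: "v \<in> V \<Longrightarrow> v' \<in> V \<Longrightarrow> \<kappa> v = \<kappa> v' \<Longrightarrow> v = v'"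
  using bij_\<kappa> by (metis bij_betw_imp_inj_on inj_onD)

lemma ne_\<kappa>: "nonerasing \<kappa>"
  unfolding nonerasing_def
proof
  fix v show "\<kappa> v \<noteq> []"
  proof (cases "v \<in> V")
    case True
    then obtain x where "x \<in> C" "\<kappa> v = rw x" by (rule \<kappa>_obtain)
    then show ?thesis using ret(1)[OF C_in_X] by (metis length_rw less_irrefl list.size(3))
  qed (simp add: \<kappa>_def)
qed

text \<open>The system induced on \<open>C\<close> in symbolic form. Asking every suffix to decode
  into \<open>C\<close> makes the set shift-invariant and forces the letters to be the successive
  return words.\<close>

definition Z where "Z = {z. \<forall>n. z n \<in> V \<and> seq_img \<kappa> (suffix n z) \<in> C}"

lemma Z_letters: "z \<in> Z \<Longrightarrow> z n \<in> V"
  by (simp add: Z_def)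

lemma Z_C: "z \<in> Z \<Longrightarrow> seq_img \<kappa> z \<in> C"
  unfolding Z_def by (metis (mono_tags, lifting) mem_Collect_eq suffix_0)

lemma suffix_Z: "z \<in> Z \<Longrightarrow> suffix k z \<in> Z"
  by (simp add: Z_def suffix_nth)

lemma Z_rw:
  assumes "z \<in> Z"
  shows "rw (seq_img \<kappa> z) = \<kappa> (z 0)" "ret (seq_img \<kappa> z) = length (\<kappa> (z 0))"
proof -
  obtain x where x: "x \<in> C" "\<kappa> (z 0) = rw x" using Z_letters[OF assms] by (rule \<kappa>_obtain)
  have "seq_img \<kappa> z = rw x \<frown> seq_img \<kappa> (suffix 1 z)"
    using seq_img_split_first[OF ne_\<kappa>, of z] by (simp only: x(2))
  from rw_eqI[OF x(1) C_in_X[OF Z_C[OF assms]] this C_prefix[OF Z_C[OF suffix_Z[OF assms]]]]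
  show "rw (seq_img \<kappa> z) = \<kappa> (z 0)" "ret (seq_img \<kappa> z) = length (\<kappa> (z 0))"
    by (simp_all add: x(2) length_rw)
qed

lemma Z_ex:
  assumes "x \<in> C"
  shows "\<exists>z\<in>Z. seq_img \<kappa> z = x"
proof -
  define xs where "xs n = ((\<lambda>x. suffix (ret x) x) ^^ n) x" for n
  have xs0: "xs 0 = x" and xsS: "xs (Suc n) = suffix (ret (xs n)) (xs n)" for n by (simp_all add: xs_def)
  have xsC: "xs n \<in> C" for n
    by (induction n) (simp_all add: xs0 xsS assms ret(2)[OF C_in_X])
  have "\<exists>z. \<forall>n. z n \<in> V \<and> \<kappa> (z n) = rw (xs n)"
    by (rule choice) (metis rw_obtain[OF xsC])
  then obtain z where z: "\<And>n. z n \<in> V" "\<And>n. \<kappa> (z n) = rw (xs n)" by blast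
  have step: "xs n = \<kappa> (z n) \<frown> xs (Suc n)" for n
    unfolding z(2) xsS rw_def by (rule prefix_suffix)
  have "xs m = word_img \<kappa> (prefix n (suffix m z)) \<frown> xs (m + n)" for m n
  proof (induction n)
    case (Suc n)
    then show ?case using step[of "m + n"] by (simp add: subseq_to_Suc suffix_nth)
  qed simp
  from seq_img_eqI[OF ne_\<kappa> this] have xs: "xs m = seq_img \<kappa> (suffix m z)" for m .
  then have "z \<in> Z" unfolding Z_def using z(1) xsC by simp
  moreover have "seq_img \<kappa> z = x" using xs[of 0] by (simp add: xs0)
  ultimately show ?thesis by blast
qed

lemma seq_img_\<kappa>_inj:
  assumes "z \<in> Z" "z' \<in> Z" "seq_img \<kappa> z = seq_img \<kappa> z'"
  shows "z = z'"
proof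
  have first: "z 0 = z' 0" if "z \<in> Z" "z' \<in> Z" "seq_img \<kappa> z = seq_img \<kappa> z'" for z z'
    using Z_rw(1)[OF that(1)] Z_rw(1)[OF that(2)] that \<kappa>_inj Z_letters by metis
  have step: "seq_img \<kappa> (suffix n z) = seq_img \<kappa> (suffix n z')" for n
  proof (induction n)
    case (Suc n)
    have "suffix n z 0 = suffix n z' 0" using first[OF suffix_Z suffix_Z Suc] assms by blast
    then have "cut \<kappa> (suffix n z) 1 = cut \<kappa> (suffix n z') 1" by (simp only: cut_1)
    then have "seq_img \<kappa> (suffix 1 (suffix n z)) = seq_img \<kappa> (suffix 1 (suffix n z'))"
      using suffix_seq_img[OF ne_\<kappa>, of "suffix n z" 1] suffix_seq_img[OF ne_\<kappa>, of "suffix n z'" 1] Suc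
      by (simp only:)
    then show ?case by simp
  qed (simp add: assms(3))
  fix n
  show "z n = z' n" using first[OF suffix_Z suffix_Z step[of n]] assms by (simp add: suffix_nth)
qed

text \<open>A visit to \<open>C\<close> strictly inside a block would be earlier than the return
  time of that block.\<close>

lemma Z_return_cut:
  assumes "z \<in> Z" "suffix j (seq_img \<kappa> z) \<in> C"
  shows "\<exists>q. j = cut \<kappa> z q"
proof -
  obtain q i where qi: "i < length (\<kappa> (z q))" "j = cut \<kappa> z q + i"
    using position_in_image[OF ne_\<kappa>, of z j] by blast
  have "suffix j (seq_img \<kappa> z) = suffix i (seq_img \<kappa> (suffix q z))"
    using suffix_seq_img[OF ne_\<kappa>, of z q] by (simp only: qi(2) suffix_suffix[symmetric])
  then have "i = 0"
    using ret_le[of i "seq_img \<kappa> (suffix q z)"] Z_rw(2)[OF suffix_Z[OF assms(1)], of q] assms(2) qi(1)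
    by (auto simp: suffix_nth)
  then show ?thesis using qi(2) by auto
qed

section \<open>Towers over \<open>C\<close>\<close>

lemma C_below:
  assumes "y \<in> X"
  shows "\<exists>x\<in>C. \<exists>i < ret x. y = suffix i x"
proof -
  obtain G where G: "\<And>x. x \<in> X \<Longrightarrow> \<exists>t\<le>G. suffix t x \<in> C" using C_gaps by blast
  obtain y' where y': "y' \<in> X" "suffix G y' = y" using suffix_surj[OF assms] by blast
  \<comment> \<open>The last visit to \<open>C\<close> not after \<open>y\<close>: between it and
    \<open>y\<close> there is no further return, so \<open>y\<close> is on a floor of its
    tower.\<close>
  define t where "t = Max {t. t \<le> G \<and> suffix t y' \<in> C}"
  have fin: "finite {t. t \<le> G \<and> suffix t y' \<in> C}" by (rule finite_subset[of _ "{..G}"]) auto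
  have "t \<in> {t. t \<le> G \<and> suffix t y' \<in> C}"
    unfolding t_def using G[OF y'(1)] by (intro Max_in fin) blast
  then have t: "t \<le> G" "suffix t y' \<in> C" by simp_all
  let ?x = "suffix t y'"
  have "G - t < ret ?x"
  proof (rule ccontr)
    assume H: "\<not> G - t < ret ?x"
    have "suffix (t + ret ?x) y' \<in> C" using ret(2)[OF C_in_X[OF t(2)]] by simp
    then have "t + ret ?x \<le> t" unfolding t_def using H t(1) by (intro Max_ge fin) (simp add: t_def)
    then show False using ret(1)[OF C_in_X[OF t(2)]] by simp
  qed
  moreover have "y = suffix (G - t) ?x" using y'(2) t(1) by simp
  ultimately show ?thesis using t(2) by blast
qed

text \<open>Since \<open>b\<close> is in the base, it never occurs at positive height, so descending
  a tower is unambiguous.\<close>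

lemma return_avoids_b: "0 < k \<Longrightarrow> k < ret x \<Longrightarrow> suffix k x \<noteq> b"
  using ret_le[of k x] b_in_C by (metis leD)

text \<open>Descend \<open>i'\<close> floors on both sides. In the tower of \<open>x\<close> this
  meets no \<open>b\<close>, so both descents end at the same point. On the other side this point is
  in \<open>C\<close>, hence it is also the bottom of the tower of \<open>x\<close>.\<close>

lemma C_below_unique:
  assumes "x \<in> C" "x' \<in> C" "i < ret x" "i' < ret x'" "i' \<le> i" "suffix i x = suffix i' x'"
  shows "x = x' \<and> i = i'"
proof -
  have "suffix (i - i') x = x'"
  proof (rule backtrack[where m = i', OF suffix_X[OF C_in_X[OF assms(1)]] C_in_X[OF assms(2)]])
    show "suffix i' (suffix (i - i') x) = suffix i' x'" using assms(5,6) by simp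
  next
    fix k assume k: "0 < k" "k \<le> i'"
    then show "suffix k (suffix (i - i') x) \<noteq> b"
      using return_avoids_b[of "i - i' + k" x] assms(3,5) by simp
  qed
  moreover from this have "i - i' = 0"
    using ret_le[of "i - i'" x] assms(2,3) by (cases "i - i' = 0") auto
  ultimately show ?thesis using assms(5) by simp
qed

lemma tower_\<kappa>: "tower_partition \<kappa> Z X"
  unfolding tower_partition_def
proof (intro conjI ballI allI impI)
  fix z i assume "z \<in> Z"
  then show "suffix i (seq_img \<kappa> z) \<in> X" by (intro suffix_X C_in_X Z_C)
next
  fix y assume "y \<in> X"
  then obtain x i where xi: "x \<in> C" "i < ret x" "y = suffix i x" using C_below by blast
  then obtain z where "z \<in> Z" "seq_img \<kappa> z = x" using Z_ex by blast
  then show "\<exists>z\<in>Z. \<exists>i < length (\<kappa> (z 0)). y = suffix i (seq_img \<kappa> z)"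
    using xi Z_rw(2) by metis
next
  fix z z' i i' assume "z \<in> Z" "z' \<in> Z" "i < length (\<kappa> (z 0))" "i' < length (\<kappa> (z' 0))"
    and eq: "suffix i (seq_img \<kappa> z) = suffix i' (seq_img \<kappa> z')"
  then have *: "seq_img \<kappa> z \<in> C" "seq_img \<kappa> z' \<in> C" "i < ret (seq_img \<kappa> z)" "i' < ret (seq_img \<kappa> z')"
    by (simp_all add: Z_C Z_rw(2))
  have "seq_img \<kappa> z = seq_img \<kappa> z' \<and> i = i'"
    using C_below_unique[OF *(1,2,3,4) _ eq] C_below_unique[OF *(2,1,4,3) _ eq[symmetric]]
    by (metis nle_le)
  then show "z = z'" "i = i'" using seq_img_\<kappa>_inj \<open>z \<in> Z\<close> \<open>z' \<in> Z\<close> by blast+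
qed

section \<open>The substitution on return words\<close>

text \<open>The word before the final \<open>s\<close> is what \<open>\<Psi> x\<close> reads between
  two visits to \<open>C\<close>, hence a product of return words. The last clause frees the choice
  of \<open>ws\<close> from the particular \<open>x\<close>: whatever point of \<open>C\<close>
  follows, each letter of \<open>ws\<close> begins with the prefix of \<open>b\<close> that
  certifies a visit to \<open>C\<close>.\<close>

lemma return_decomposition:
  assumes "v \<in> V"
  shows "\<exists>ws. set ws \<subseteq> V \<and> s @ word_img \<tau> (\<kappa> v) = word_img \<kappa> ws @ s \<and>
    (\<forall>i < length ws. \<forall>x\<in>C. prefix M (word_img \<kappa> (drop i ws) \<frown> x) = prefix M b)"
proof -
  obtain x where x: "x \<in> C" "\<kappa> v = rw x" using assms by (rule \<kappa>_obtain)
  let ?x' = "suffix (ret x) x"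
  have x': "?x' \<in> C" by (rule ret(2)[OF C_in_X[OF x(1)]])
  obtain z where z: "z \<in> Z" "seq_img \<kappa> z = \<Psi> x" using Z_ex[OF \<Psi>_C[OF x(1)]] by blast
  have next_ret: "suffix (cut \<tau> x (ret x)) (\<Psi> x) = \<Psi> ?x'" by (rule suffix_cut_\<Psi>[OF x(1) x'])
  then obtain q where q: "cut \<tau> x (ret x) = cut \<kappa> z q"
    using Z_return_cut[OF z(1)] \<Psi>_C[OF x'] z(2) by metis
  let ?ws = "prefix q z"
  obtain B where B: "s @ word_img \<tau> (\<kappa> v) = B @ s"
    using s_conjugates[OF x(1) x'] unfolding x(2) rw_def by blast
  have len: "length B = cut \<tau> x (ret x)"
    by (metis B add.commute add_right_cancel length_append x(2) rw_def)
  have "\<Psi> x = (s @ word_img \<tau> (\<kappa> v)) \<frown> T ?x'"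
    unfolding x(2) rw_def by (simp only: \<Psi>_def conc_conc[symmetric] seq_img_split[OF ne, of x "ret x", symmetric])
  then have "\<Psi> x = B \<frown> \<Psi> ?x'" unfolding B by (simp add: \<Psi>_def)
  then have "B = prefix (length B) (seq_img \<kappa> z)" unfolding z(2) by simp
  also have "\<dots> = word_img \<kappa> ?ws" unfolding len q by (rule prefix_seq_img[OF ne_\<kappa>])
  finally have B_eq: "B = word_img \<kappa> ?ws" .
  have "prefix M (word_img \<kappa> (drop i ?ws) \<frown> y) = prefix M b" if i: "i < length ?ws" and y: "y \<in> C" for i y
  proof -
    have "drop i ?ws = prefix (q - i) (suffix i z)"
      by (simp add: subsequence_prefix_suffix)
    moreover have "suffix (q - i) (suffix i z) = suffix q z" using i by simp
    ultimately have "seq_img \<kappa> (suffix i z) = word_img \<kappa> (drop i ?ws) \<frown> seq_img \<kappa> (suffix q z)"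
      using seq_img_split[OF ne_\<kappa>, of "suffix i z" "q - i"] by simp
    then have "prefix M (word_img \<kappa> (drop i ?ws) \<frown> seq_img \<kappa> (suffix q z)) = prefix M b"
      using C_prefix[OF Z_C[OF suffix_Z[OF z(1)]], of i] by simp
    moreover have "prefix M y = prefix M (seq_img \<kappa> (suffix q z))"
      using C_prefix[OF y] C_prefix[OF Z_C[OF suffix_Z[OF z(1)]]] by simp
    ultimately show ?thesis using prefix_conc_agree by metis
  qed
  moreover have "set ?ws \<subseteq> V" using Z_letters[OF z(1)] by auto
  ultimately show ?thesis using B B_eq by blast
qed

text \<open>Outside \<open>V\<close> the identity is taken, so that \<open>\<theta>\<close> is
  nonerasing everywhere.\<close>

definition \<theta> where
  "\<theta> v = (if v \<in> V then SOME ws. set ws \<subseteq> V \<and> s @ word_img \<tau> (\<kappa> v) = word_img \<kappa> ws @ s \<and>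
    (\<forall>i < length ws. \<forall>x\<in>C. prefix M (word_img \<kappa> (drop i ws) \<frown> x) = prefix M b) else [v])"

lemma \<theta>:
  assumes "v \<in> V"
  shows "set (\<theta> v) \<subseteq> V" "s @ word_img \<tau> (\<kappa> v) = word_img \<kappa> (\<theta> v) @ s"
    "i < length (\<theta> v) \<Longrightarrow> x \<in> C \<Longrightarrow> prefix M (word_img \<kappa> (drop i (\<theta> v)) \<frown> x) = prefix M b"
  using someI_ex[OF return_decomposition[OF assms]] assms unfolding \<theta>_def by simp_all

lemma length_\<kappa>_\<theta>: "v \<in> V \<Longrightarrow> length (word_img \<kappa> (\<theta> v)) = length (word_img \<tau> (\<kappa> v))"
  by (metis \<theta>(2) add.commute add_right_cancel length_append)

lemma ne_\<theta>: "nonerasing \<theta>"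
  unfolding nonerasing_def
proof
  fix v show "\<theta> v \<noteq> []"
  proof (cases "v \<in> V")
    case True
    have "0 < length (word_img \<tau> (\<kappa> v))"
      using nonerasing_length[OF ne_\<kappa>, of v] length_word_img_ge[OF ne, of "\<kappa> v"] by linarith
    then show ?thesis using length_\<kappa>_\<theta>[OF True] by auto
  qed (simp add: \<theta>_def)
qed

text \<open>The word \<open>s\<close> travels through the product from left to right, one return
  word at a time.\<close>

lemma \<theta>_conjugate:
  "set ws \<subseteq> V \<Longrightarrow> s @ word_img \<tau> (word_img \<kappa> ws) = word_img \<kappa> (word_img \<theta> ws) @ s"
proof (induction ws)
  case (Cons v ws)
  have "s @ word_img \<tau> (word_img \<kappa> (v # ws)) = (s @ word_img \<tau> (\<kappa> v)) @ word_img \<tau> (word_img \<kappa> ws)"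
    by simp
  also have "\<dots> = word_img \<kappa> (\<theta> v) @ (s @ word_img \<tau> (word_img \<kappa> ws))"
    using \<theta>(2)[of v] Cons.prems by simp
  also have "\<dots> = word_img \<kappa> (word_img \<theta> (v # ws)) @ s" using Cons by simp
  finally show ?case .
qed simp

lemma set_prefix_Z: "z \<in> Z \<Longrightarrow> set (prefix n z) \<subseteq> V"
  using Z_letters by auto

lemma \<Psi>_seq_img:
  assumes "z \<in> Z"
  shows "\<Psi> (seq_img \<kappa> z) = seq_img \<kappa> (seq_img \<theta> z)"
  unfolding seq_img_seq_img[OF ne_\<kappa> ne_\<theta>]
proof (rule seq_img_eqI[OF nonerasing_comp[OF ne_\<kappa> ne_\<theta>]])
  fix n
  have "\<Psi> (seq_img \<kappa> z) = (s @ word_img \<tau> (word_img \<kappa> (prefix n z))) \<frown> T (seq_img \<kappa> (suffix n z))"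
    unfolding \<Psi>_def by (subst seq_img_split[OF ne_\<kappa>, of z n]) (simp add: seq_img_conc[OF ne])
  also have "\<dots> = word_img \<kappa> (word_img \<theta> (prefix n z)) \<frown> \<Psi> (seq_img \<kappa> (suffix n z))"
    unfolding \<theta>_conjugate[OF set_prefix_Z[OF assms]] by (simp add: \<Psi>_def)
  finally show "\<Psi> (seq_img \<kappa> z) =
      word_img (\<lambda>a. word_img \<kappa> (\<theta> a)) (prefix n z) \<frown> \<Psi> (seq_img \<kappa> (suffix n z))"
    unfolding word_img_word_img .
qed

text \<open>Each position lies in some block of \<open>\<theta>\<close>, and the rest of this block
  is followed by a point decoding into \<open>C\<close>, so the last clause in the choice of
  \<open>\<theta>\<close> applies.\<close>

lemma \<theta>_Z:
  assumes "z \<in> Z"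
  shows "seq_img \<theta> z \<in> Z"
  unfolding Z_def
proof (intro CollectI allI conjI)
  fix n
  obtain q i where qi: "i < length (\<theta> (z q))" "n = cut \<theta> z q + i"
    using position_in_image[OF ne_\<theta>, of z n] by blast
  have v: "z q \<in> V" by (rule Z_letters[OF assms])
  have "suffix n (seq_img \<theta> z) = suffix i (seq_img \<theta> (suffix q z))"
    using suffix_seq_img[OF ne_\<theta>, of z q] by (simp only: qi(2) suffix_suffix[symmetric])
  also have "\<dots> = drop i (\<theta> (z q)) \<frown> seq_img \<theta> (suffix (Suc q) z)"
    by (subst seq_img_split_first[OF ne_\<theta>]) (use qi(1) in \<open>simp add: suffix_nth\<close>)
  finally have suf: "suffix n (seq_img \<theta> z) = drop i (\<theta> (z q)) \<frown> seq_img \<theta> (suffix (Suc q) z)" .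
  have "seq_img \<theta> z n = suffix n (seq_img \<theta> z) 0" by (simp add: suffix_nth)
  also have "\<dots> = \<theta> (z q) ! i" unfolding suf using qi(1) by simp
  finally show "seq_img \<theta> z n \<in> V" using \<theta>(1)[OF v] nth_mem[OF qi(1)] by auto
  have eq: "seq_img \<kappa> (suffix n (seq_img \<theta> z)) =
      word_img \<kappa> (drop i (\<theta> (z q))) \<frown> \<Psi> (seq_img \<kappa> (suffix (Suc q) z))"
    unfolding suf \<Psi>_seq_img[OF suffix_Z[OF assms]] by (rule seq_img_conc[OF ne_\<kappa>])
  show "seq_img \<kappa> (suffix n (seq_img \<theta> z)) \<in> C"
  proof (rule C_I)
    show "seq_img \<kappa> (suffix n (seq_img \<theta> z)) \<in> X"
      using suffix_X[OF C_in_X[OF \<Psi>_C[OF Z_C[OF assms]]]]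
      unfolding suffix_seq_img[OF ne_\<kappa>, symmetric] \<Psi>_seq_img[OF assms] .
    show "prefix M (seq_img \<kappa> (suffix n (seq_img \<theta> z))) = prefix M b"
      unfolding eq by (rule \<theta>(3)[OF v qi(1) \<Psi>_C[OF Z_C[OF suffix_Z[OF assms]]]])
  qed
qed

lemma \<theta>_pow_Z: "z \<in> Z \<Longrightarrow> (seq_img \<theta> ^^ n) z \<in> Z"
  by (induction n) (auto simp: \<theta>_Z)

lemma \<Psi>_pow_seq_img: "z \<in> Z \<Longrightarrow> (\<Psi> ^^ n) (seq_img \<kappa> z) = seq_img \<kappa> ((seq_img \<theta> ^^ n) z)"
  by (induction n) (auto simp: \<Psi>_seq_img \<theta>_pow_Z)

section \<open>Towers over the image of \<open>C\<close>\<close>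

lemma X_covered_by_images: "x \<in> X \<Longrightarrow> \<exists>y\<in>X. \<exists>j. x = suffix j (T y)"
proof -
  assume x: "x \<in> X"
  define B where "B = Max (range (\<lambda>a. length (\<tau> a)))"
  have B: "length (\<tau> a) \<le> B" for a unfolding B_def by (rule Max_ge) auto
  \<comment> \<open>The bound \<open>B\<close> keeps the union finite and hence closed; it contains
    the orbit of \<open>u\<close>.\<close>
  let ?S = "\<Union>j\<in>{..B}. (\<lambda>y. suffix j (T y)) ` X"
  have "closedin seq_top ?S"
    by (intro closedin_Union finite_imageI)
      (auto intro!: compactin_seq_top_closedin image_compactin[OF compact_X] continuous_map_suffix_seq_img ne)
  moreover have "\<exists>y\<in>?S. prefix n y = prefix n x" for n
  proof -
    obtain m where m: "prefix n (suffix m u) = prefix n x" using X_approx[OF x] by blast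
    obtain q i where qi: "i < length (\<tau> (u q))" "m = cut \<tau> u q + i"
      using position_in_image[OF ne, of u m] by blast
    have "suffix m u = suffix i (T (suffix q u))" by (simp add: T_suffix_u qi(2))
    moreover have "i \<le> B" using qi(1) B[of "u q"] by linarith
    ultimately have "suffix m u \<in> ?S" using orbit_in_X by blast
    then show ?thesis using m by blast
  qed
  ultimately have "x \<in> ?S" by (rule closedin_seq_topD)
  then show ?thesis by blast
qed

text \<open>Choose the least height over all \<open>y\<close> in \<open>C\<close>. A height beyond
  the tower of \<open>y\<close> could be lowered by passing to the next visit of \<open>y\<close> to
  \<open>C\<close>.\<close>

lemma C_below_\<Psi>:
  assumes "x \<in> X"
  shows "\<exists>y\<in>C. \<exists>j < cut \<tau> y (ret y). x = suffix j (\<Psi> y)"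
proof -
  define P where "P j \<longleftrightarrow> (\<exists>y\<in>C. x = suffix j (\<Psi> y))" for j
  have "\<exists>j. P j"
  proof -
    obtain y j where y: "y \<in> X" "x = suffix j (T y)" using X_covered_by_images[OF assms] by blast
    obtain y' i where y': "y' \<in> C" "y = suffix i y'" using C_below[OF y(1)] by blast
    have "x = suffix (l + cut \<tau> y' i + j) (\<Psi> y')"
      using suffix_seq_img[OF ne, of y' i] suffix_\<Psi>[of y'] y(2) y'(2) by (simp flip: suffix_suffix)
    then show ?thesis unfolding P_def using y'(1) by blast
  qed
  then have least: "P (LEAST j. P j)" by (rule LeastI_ex)
  define j where "j = (LEAST j. P j)"
  obtain y where y: "y \<in> C" "x = suffix j (\<Psi> y)" using least unfolding P_def j_def[symmetric, unfolded P_def] by blast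
  have "j < cut \<tau> y (ret y)"
  proof (rule ccontr)
    let ?c = "cut \<tau> y (ret y)"
    assume "\<not> j < ?c"
    have r: "suffix (ret y) y \<in> C" "0 < ret y" using ret C_in_X[OF y(1)] by blast+
    have "x = suffix (j - ?c) (\<Psi> (suffix (ret y) y))"
      unfolding suffix_cut_\<Psi>[OF y(1) r(1), symmetric] using y(2) \<open>\<not> j < ?c\<close> by simp
    then have "P (j - ?c)" unfolding P_def using r(1) by blast
    then have "j \<le> j - ?c" unfolding j_def by (rule Least_le)
    moreover have "0 < ?c" using cut_ge[OF ne, of "ret y" y] r(2) by linarith
    ultimately show False using \<open>\<not> j < ?c\<close> by linarith
  qed
  then show ?thesis using y by blast
qed

lemma \<Psi>_return_late:
  assumes "x \<in> C" "x' \<in> C" "suffix j (\<Psi> x) = \<Psi> x'" "j < cut \<tau> x (ret x)"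
  shows "j = 0 \<and> x = x'"
proof -
  obtain q where q: "j = cut \<tau> x q" "suffix q x = x'" using \<Psi>_return[OF assms(1-3)] by blast
  have "q < ret x" using assms(4) unfolding q(1) by (rule cut_less_cancel)
  then have "q = 0" using ret_le[of q x] q(2) assms(2) by (cases "q = 0") auto
  then show ?thesis using q by simp
qed

text \<open>The descent used for \<open>C\<close> works again: \<open>b = \<Psi> b\<close> lies in
  the new base as well, so it does not occur at positive height.\<close>

lemma C_below_\<Psi>_unique:
  assumes "x \<in> C" "x' \<in> C" "j < cut \<tau> x (ret x)" "j' < cut \<tau> x' (ret x')" "j' \<le> j"
    "suffix j (\<Psi> x) = suffix j' (\<Psi> x')"
  shows "x = x' \<and> j = j'"
proof -
  have "\<Psi> x' = suffix (j - j') (\<Psi> x)"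
  proof (rule backtrack[where m = j', OF C_in_X[OF \<Psi>_C[OF assms(2)]] suffix_X[OF C_in_X[OF \<Psi>_C[OF assms(1)]]]])
    show "suffix j' (\<Psi> x') = suffix j' (suffix (j - j') (\<Psi> x))" using assms(5,6) by simp
  next
    fix k assume k: "0 < k" "k \<le> j'"
    show "suffix k (\<Psi> x') \<noteq> b"
    proof
      assume "suffix k (\<Psi> x') = b"
      then have "suffix k (\<Psi> x') = \<Psi> b" by (simp only: \<Psi>_b)
      from \<Psi>_return_late[OF assms(2) b_in_C this] k assms(4) show False by simp
    qed
  qed
  moreover have "j - j' < cut \<tau> x (ret x)" using assms(3) by linarith
  ultimately have "j - j' = 0 \<and> x = x'" using \<Psi>_return_late[OF assms(1,2)] by metis
  then show ?thesis using assms(5) by simp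
qed

lemma cut_ret_Z:
  assumes "z \<in> Z"
  shows "cut \<tau> (seq_img \<kappa> z) (ret (seq_img \<kappa> z)) = cut \<kappa> (seq_img \<theta> z) (length (\<theta> (z 0)))"
proof -
  have "cut \<tau> (seq_img \<kappa> z) (ret (seq_img \<kappa> z)) = length (word_img \<tau> (\<kappa> (z 0)))"
    using Z_rw(1)[OF assms] by (simp only: rw_def)
  moreover have "prefix (length (\<theta> (z 0))) (seq_img \<theta> z) = \<theta> (z 0)"
    by (subst seq_img_split_first[OF ne_\<theta>]) simp
  ultimately show ?thesis using length_\<kappa>_\<theta>[OF Z_letters[OF assms]] by simp
qed

text \<open>The towers over the image of \<open>C\<close> are restricted to their visits to
  \<open>C\<close> and decoded by \<open>\<kappa>\<close>. Heights are thereby counted in return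
  words instead of letters.\<close>

lemma tower_\<theta>: "tower_partition \<theta> Z Z"
  unfolding tower_partition_def
proof (intro conjI ballI allI impI)
  fix z i assume "z \<in> Z"
  then show "suffix i (seq_img \<theta> z) \<in> Z" by (intro suffix_Z \<theta>_Z)
next
  fix z assume z: "z \<in> Z"
  obtain x j where xj: "x \<in> C" "j < cut \<tau> x (ret x)" "seq_img \<kappa> z = suffix j (\<Psi> x)"
    using C_below_\<Psi>[OF C_in_X[OF Z_C[OF z]]] by blast
  obtain z' where z': "z' \<in> Z" "seq_img \<kappa> z' = x" using Z_ex[OF xj(1)] by blast
  have \<Psi>: "\<Psi> x = seq_img \<kappa> (seq_img \<theta> z')" using \<Psi>_seq_img[OF z'(1)] z'(2) by simp
  obtain i where i: "j = cut \<kappa> (seq_img \<theta> z') i"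
    using Z_return_cut[OF \<theta>_Z[OF z'(1)]] Z_C[OF z] xj(3) \<Psi> by metis
  have "cut \<kappa> (seq_img \<theta> z') i < cut \<kappa> (seq_img \<theta> z') (length (\<theta> (z' 0)))"
    using xj(2) cut_ret_Z[OF z'(1)] unfolding z'(2) i by (simp only:)
  then have "i < length (\<theta> (z' 0))" by (rule cut_less_cancel)
  moreover have "seq_img \<kappa> z = seq_img \<kappa> (suffix i (seq_img \<theta> z'))"
    unfolding xj(3) \<Psi> i by (rule suffix_seq_img[OF ne_\<kappa>])
  then have "z = suffix i (seq_img \<theta> z')"
    by (rule seq_img_\<kappa>_inj[OF z suffix_Z[OF \<theta>_Z[OF z'(1)]]])
  ultimately show "\<exists>z'\<in>Z. \<exists>i < length (\<theta> (z' 0)). z = suffix i (seq_img \<theta> z')" using z'(1) by blast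
next
  fix z z' i i' assume z: "z \<in> Z" "z' \<in> Z" and i: "i < length (\<theta> (z 0))" "i' < length (\<theta> (z' 0))"
    and eq: "suffix i (seq_img \<theta> z) = suffix i' (seq_img \<theta> z')"
  let ?x = "seq_img \<kappa> z" and ?x' = "seq_img \<kappa> z'"
  let ?j = "cut \<kappa> (seq_img \<theta> z) i" and ?j' = "cut \<kappa> (seq_img \<theta> z') i'"
  have C: "?x \<in> C" "?x' \<in> C" using z Z_C by blast+
  have j: "?j < cut \<tau> ?x (ret ?x)" "?j' < cut \<tau> ?x' (ret ?x')"
    unfolding cut_ret_Z[OF z(1)] cut_ret_Z[OF z(2)]
    using i by (simp_all only: length_word_img_prefix_strict_mono[OF ne_\<kappa>])
  have e: "suffix ?j (\<Psi> ?x) = suffix ?j' (\<Psi> ?x')"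
    using eq unfolding \<Psi>_seq_img[OF z(1)] \<Psi>_seq_img[OF z(2)] suffix_seq_img[OF ne_\<kappa>] by simp
  have "?x = ?x' \<and> ?j = ?j'"
    using C_below_\<Psi>_unique[OF C j _ e] C_below_\<Psi>_unique[OF C(2,1) j(2,1) _ e[symmetric]]
    by (metis nle_le)
  then show "z = z'" "i = i'"
    using seq_img_\<kappa>_inj[OF z] cut_inject[OF ne_\<kappa>] by metis+
qed

section \<open>The codes form stationary towers\<close>

lemma closed_Z: "closedin seq_top Z"
  unfolding closedin_seq_top_iff
proof (intro allI impI)
  fix x assume x: "\<forall>n. \<exists>y\<in>Z. prefix n y = prefix n x"
  have "x n \<in> V \<and> seq_img \<kappa> (suffix n x) \<in> C" for n
  proof
    obtain y where "y \<in> Z" "prefix (Suc n) y = prefix (Suc n) x" using x by blast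
    then show "x n \<in> V" using Z_letters[of y n] by (simp add: prefix_eq_iff)
    have "\<exists>y\<in>C. prefix N y = prefix N (seq_img \<kappa> (suffix n x))" for N
    proof -
      obtain y where y: "y \<in> Z" "prefix (n + N) y = prefix (n + N) x" using x by blast
      have "prefix N (seq_img \<kappa> (suffix n y)) = prefix N (seq_img \<kappa> (suffix n x))"
        by (rule prefix_seq_img_agree'[OF ne_\<kappa> prefix_suffix_eq[OF y(2)]])
      then show ?thesis using Z_C[OF suffix_Z[OF y(1)]] by blast
    qed
    then show "seq_img \<kappa> (suffix n x) \<in> C" by (rule closedin_seq_topD[OF closed_C])
  qed
  then show "x \<in> Z" by (simp add: Z_def)
qed

lemma Z_occurs: "v \<in> V \<Longrightarrow> \<exists>z\<in>Z. z 0 = v"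
proof -
  assume v: "v \<in> V"
  then obtain x where x: "x \<in> C" "\<kappa> v = rw x" by (rule \<kappa>_obtain)
  obtain z where z: "z \<in> Z" "seq_img \<kappa> z = x" using Z_ex[OF x(1)] by blast
  have "\<kappa> (z 0) = \<kappa> v" using Z_rw(1)[OF z(1)] z(2) x(2) by simp
  then show ?thesis using \<kappa>_inj[OF Z_letters[OF z(1)] v] z(1) by blast
qed

sublocale towers: stationary_towers V \<theta> \<kappa> Z X
proof
  show "compactin seq_top Z" by (rule compactin_seq_top[OF closed_Z finite_V]) (rule Z_letters)
  show "\<exists>n. \<forall>z\<in>Z. \<forall>z'\<in>Z. prefix N (seq_img \<kappa> ((seq_img \<theta> ^^ n) z)) =
      prefix N (seq_img \<kappa> ((seq_img \<theta> ^^ n) z'))" for N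
  proof -
    obtain n where n: "\<And>x. x \<in> C \<Longrightarrow> prefix N ((\<Psi> ^^ n) x) = prefix N b"
      using \<Psi>_pow_agree[of N] by blast
    have "prefix N (seq_img \<kappa> ((seq_img \<theta> ^^ n) z)) = prefix N b" if "z \<in> Z" for z
      using n[OF Z_C[OF that]] \<Psi>_pow_seq_img[OF that, of n] by simp
    then show ?thesis by (intro exI[of _ n] ballI) simp
  qed
  show "\<exists>z\<in>Z. seq_img \<theta> z = z"
  proof -
    \<comment> \<open>The code of \<open>b\<close> is fixed by \<open>\<theta>\<close> because
      \<open>\<Psi>\<close> fixes \<open>b\<close> and decoding is injective.\<close>
    obtain z where z: "z \<in> Z" "seq_img \<kappa> z = b" using Z_ex[OF b_in_C] by blast
    have "seq_img \<kappa> (seq_img \<theta> z) = seq_img \<kappa> z" using \<Psi>_seq_img[OF z(1)] by (simp add: z(2) \<Psi>_b)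
    then show ?thesis using seq_img_\<kappa>_inj[OF \<theta>_Z[OF z(1)] z(1)] z(1) by blast
  qed
qed (use finite_V ne_\<theta> ne_\<kappa> compact_X Z_letters Z_occurs suffix_Z tower_\<kappa> tower_\<theta> in blast)+

section \<open>Primitivity and the vertices of the diagram\<close>

text \<open>A return word followed by the first \<open>M\<close> letters of \<open>b\<close> recurs
  with bounded gaps. Each occurrence is a visit to \<open>C\<close> with this return word, so it
  starts at a block boundary.\<close>

lemma Z_occurs_bounded:
  assumes "v \<in> V"
  shows "\<exists>G. \<forall>z\<in>Z. \<exists>q. z q = v \<and> cut \<kappa> z q \<le> G"
proof -
  obtain x where x: "x \<in> C" "\<kappa> v = rw x" using assms by (rule \<kappa>_obtain)
  obtain G where G: "\<And>y. y \<in> X \<Longrightarrow> \<exists>t\<le>G. prefix (ret x + M) (suffix t y) = prefix (ret x + M) x"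
    using uniformly_recurrent[OF C_in_X[OF x(1)], of "ret x + M"] by blast
  have "\<exists>q. z q = v \<and> cut \<kappa> z q \<le> G" if z: "z \<in> Z" for z
  proof -
    have zX: "seq_img \<kappa> z \<in> X" by (rule C_in_X[OF Z_C[OF z]])
    obtain t where t: "t \<le> G" "prefix (ret x + M) (suffix t (seq_img \<kappa> z)) = prefix (ret x + M) x"
      using G[OF zX] by blast
    let ?y = "suffix t (seq_img \<kappa> z)"
    have "prefix (ret x) ?y = prefix (ret x) x" by (rule prefix_mono_eq[OF t(2)]) simp
    then have y: "?y = rw x \<frown> suffix (ret x) ?y" unfolding rw_def by (metis prefix_suffix)
    have "prefix M (suffix (ret x) ?y) = prefix M (suffix (ret x) x)" by (rule prefix_suffix_eq[OF t(2)])
    then have M: "prefix M (suffix (ret x) ?y) = prefix M b"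
      using C_prefix[OF ret(2)[OF C_in_X[OF x(1)]]] by simp
    note rwy = rw_eqI[OF x(1) suffix_X[OF zX] y M]
    obtain q where q: "t = cut \<kappa> z q" using Z_return_cut[OF z rwy(1)] by blast
    have "?y = seq_img \<kappa> (suffix q z)" unfolding q by (rule suffix_seq_img[OF ne_\<kappa>])
    then have "\<kappa> (suffix q z 0) = \<kappa> v" using Z_rw(1)[OF suffix_Z[OF z], of q] rwy(3) x(2) by simp
    then have "z q = v" using \<kappa>_inj[OF Z_letters[OF z] assms] by (simp add: suffix_nth)
    then show ?thesis using t(1) q by blast
  qed
  then show ?thesis by blast
qed

lemma \<theta>_pow_letters: "v \<in> V \<Longrightarrow> set (word_pow \<theta> p v) \<subseteq> V"
proof (induction p)
  case (Suc p)
  have "set (word_pow \<theta> (Suc p) v) = (\<Union>c\<in>set (word_pow \<theta> p v). set (\<theta> c))" by simp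
  with Suc show ?case using \<theta>(1) by blast
qed simp

text \<open>Iterating the conjugation accumulates the same word \<open>S\<close> on both sides, and
  it cancels in the lengths.\<close>

lemma length_\<kappa>_\<theta>_pow:
  "v \<in> V \<Longrightarrow> length (word_img \<kappa> (word_pow \<theta> p v)) = length ((word_img \<tau> ^^ p) (\<kappa> v))"
proof -
  assume v: "v \<in> V"
  have "\<exists>S. S @ (word_img \<tau> ^^ p) (\<kappa> v) = word_img \<kappa> (word_pow \<theta> p v) @ S"
  proof (induction p)
    case (Suc p)
    then obtain S where S: "S @ (word_img \<tau> ^^ p) (\<kappa> v) = word_img \<kappa> (word_pow \<theta> p v) @ S" by blast
    have "(s @ word_img \<tau> S) @ (word_img \<tau> ^^ Suc p) (\<kappa> v) =
        s @ word_img \<tau> (S @ (word_img \<tau> ^^ p) (\<kappa> v))" by simp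
    also have "\<dots> = word_img \<kappa> (word_pow \<theta> (Suc p) v) @ (s @ word_img \<tau> S)"
      unfolding S using \<theta>_conjugate[OF \<theta>_pow_letters[OF v, of p]] by simp
    finally show ?case by blast
  qed (auto intro: exI[of _ "[]"])
  then show ?thesis by (metis add.commute add_right_cancel length_append)
qed

lemma primitive_\<theta>: "primitive_on V \<theta>"
proof -
  have "\<exists>G. \<forall>v\<in>V. \<forall>z\<in>Z. \<exists>q. z q = v \<and> cut \<kappa> z q \<le> G"
  proof -
    obtain G where G: "\<And>v. v \<in> V \<Longrightarrow> \<forall>z\<in>Z. \<exists>q. z q = v \<and> cut \<kappa> z q \<le> G v"
      using Z_occurs_bounded by metis
    have "G v \<le> Max (G ` V)" if "v \<in> V" for v using finite_V that by (intro Max_ge) auto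
    then show ?thesis using G by (meson order_trans)
  qed
  then obtain G where G: "\<And>v z. v \<in> V \<Longrightarrow> z \<in> Z \<Longrightarrow> \<exists>q. z q = v \<and> cut \<kappa> z q \<le> G" by blast
  \<comment> \<open>Once the first block is longer than \<open>G\<close>, every letter must already
    occur inside it. The excess 2 rules out \<open>p = 0\<close>, where the words have length
    1.\<close>
  obtain p where p: "\<And>a. G + 2 \<le> length (word_pow \<tau> p a)" using word_pow_long[of "G + 2"] by blast
  have "p \<noteq> 0" using p[of undefined] by (cases p) simp_all
  moreover have "v \<in> set (word_pow \<theta> p a)" if a: "a \<in> V" and v: "v \<in> V" for a v
  proof -
    obtain z where z: "z \<in> Z" "z 0 = a" using Z_occurs[OF a] by blast
    let ?z = "(seq_img \<theta> ^^ p) z" and ?W = "word_pow \<theta> p a"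
    obtain q where q: "?z q = v" "cut \<kappa> ?z q \<le> G" using G[OF v \<theta>_pow_Z[OF z(1)]] by blast
    have z_eq: "?z = ?W \<frown> seq_img (word_pow \<theta> p) (suffix 1 z)"
      unfolding seq_img_pow[OF ne_\<theta>] z(2)[symmetric] by (rule seq_img_split_first[OF nonerasing_pow[OF ne_\<theta>]])
    have "q < length ?W"
    proof (rule ccontr)
      assume "\<not> q < length ?W"
      then have "cut \<kappa> ?z (length ?W) \<le> cut \<kappa> ?z q" by (intro length_word_img_prefix_mono) simp
      moreover have "prefix (length ?W) ?z = ?W" unfolding z_eq by simp
      ultimately have le: "length ((word_img \<tau> ^^ p) (\<kappa> a)) \<le> G"
        using q(2) length_\<kappa>_\<theta>_pow[OF a, of p] by simp
      obtain c w where "\<kappa> a = c # w" using ne_\<kappa> unfolding nonerasing_def by (metis neq_Nil_conv)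
      then have "length (word_pow \<tau> p c) \<le> length ((word_img \<tau> ^^ p) (\<kappa> a))"
        unfolding word_img_pow[where f = \<tau> and w = "\<kappa> a"] by simp
      then show False using le p[of c] by linarith
    qed
    then have "v = ?W ! q" using q(1) z_eq by (metis conc_fst)
    then show ?thesis using \<open>q < length ?W\<close> by simp
  qed
  ultimately have "\<exists>p\<ge>1. \<forall>a\<in>V. \<forall>v\<in>V. v \<in> set (word_pow \<theta> p a)"
    by (intro exI[of _ p]) simp
  then show ?thesis using primitive_on_iff[of V \<theta>] finite_V \<theta>(1) by blast
qed

lemma stat_bratteli_\<theta>: "stat_bratteli V (\<lambda>v. length (\<kappa> v)) \<theta>"
  unfolding stat_bratteli_def
proof (intro conjI ballI)
  obtain v where "v \<in> V" using rw_obtain[OF b_in_C] by blast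
  then show "V \<noteq> {}" by blast
  fix v assume v: "v \<in> V"
  show "1 \<le> length (\<kappa> v)" using nonerasing_length[OF ne_\<kappa>, of v] by linarith
  show "\<theta> v \<noteq> []" using ne_\<theta> by (simp add: nonerasing_def)
  show "set (\<theta> v) \<subseteq> V" by (rule \<theta>(1)[OF v])
  obtain z where z: "z \<in> Z" "z 0 = v" using Z_occurs[OF v] by blast
  \<comment> \<open>Every vertex is a source because the \<open>\<theta>\<close>-towers cover
    \<open>Z\<close>: a code beginning with \<open>v\<close> sits on some floor, and the label of
    that floor is \<open>v\<close>.\<close>
  note c = tower_coords[OF tower_\<theta> z(1)]
  have "v = seq_img \<theta> (base \<theta> Z z) (height \<theta> Z z)"
    using arg_cong[OF c(3), of "\<lambda>z. z 0"] z(2) by (simp add: suffix_nth)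
  also have "\<dots> = \<theta> (base \<theta> Z z 0) ! height \<theta> Z z" by (rule seq_img_0[where x = "base \<theta> Z z", OF ne_\<theta> c(2)])
  finally show "\<exists>a\<in>V. v \<in> set (\<theta> a)" using nth_mem[OF c(2)] Z_letters[OF c(1), of 0] by metis
qed (rule finite_V)

end

theorem theorem13:
  fixes \<tau> :: "'a::finite \<Rightarrow> 'a list" and u :: "nat \<Rightarrow> 'a"
  assumes subst: "is_substitution \<tau>"
    and prim: "primitive_on UNIV \<tau>"
    and infinite: "infinite (subst_space u)"
    and recog: "unilaterally_recognizable \<tau> u"
    and inj_pow: "\<forall>n\<ge>1. inj (subst_pow \<tau> n)"
    and fixed: "subst_seq \<tau> u = u"
    and lproper: "left_proper \<tau>"
    and qinv: "quasi_invertible (subst_space u)"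
  shows "\<exists>V k \<theta>. stat_bratteli V k \<theta> \<and> semi_proper V k \<theta> \<and>
           top_conjugate (subtopology seq_top (path_space V k \<theta>)) (vershik V k \<theta>)
                         (subtopology seq_top (subst_space u)) shift"
proof -
  have "subst_pow \<tau> 1 = \<tau>" by (simp add: fun_eq_iff subst_pow_def subst_word_def)
  then have "inj \<tau>" using inj_pow by (metis order_refl)
  then interpret quasi_invertible_substitution \<tau> u
    using subst prim infinite recog fixed qinv by unfold_locales
  show ?thesis
    using stat_bratteli_\<theta> primitive_\<theta> towers.min_path_unique towers.top_conjugate_paths
    unfolding semi_proper_def by blast
qed

end
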